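(* Let $p$ be a prime, $L_0=\overline{\mathbb{F}}_p(t,t^{1/p},t^{1/p^2},\dots)$, $L$ a finite extension of $L_0$, $d\ge2$ an integer, $f_\lambda(x)=x^d+\lambda$, $\gamma\in L$ and $v\in\Omega$. Then the logarithmic capacity of the generalized Mandelbrot set $M_{\gamma,v}$ is $\mathbf{c}(M_{\gamma,v})=1$.
   Context: $\Omega$ is the set of places of $L$ lying above the places of $\overline{\mathbb{F}}_p(t)$. For $v\in\Omega$, $\mathbb{C}_v$ is an algebraically closed field containing $L$, complete w.r.t. an extension of $|\cdot|_v$, and $\mathbb{A}^1_{\mathrm{Berk},\mathbb{C}_v}$ is the Berkovich affine line over $\mathbb{C}_v$. For $\lambda\in\mathbb{C}_v$, $\hat h_{v,\lambda}(\gamma)=\lim_{n\to\infty}\log^+|f^n_\lambda(\gamma)|_v/d^n$ with $\log^+z=\log\max\{z,1\}$, extended continuously in $\lambda$ to $\mathbb{A}^1_{\mathrm{Berk},\mathbb{C}_v}$; $M_{\gamma,v}$ is its zero set. For a compact $E\subset\mathbb{A}^1_{\mathrm{Berk},\mathbb{C}_v}$, $V(E)=\inf_\mu\iint_{E\times E}-\log\delta(x,y)\,d\mu(x)d\mu(y)$, the infimum over probability measures $\mu$ supported on $E$, where $\delta$ is the Hsia kernel; the logarithmic capacity is $\mathbf{c}(E)=e^{-V(E)}$. *)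

theory Defs
  imports
    "HOL-Probability.Probability_Measure"
    "HOL-Algebra.Algebraic_Closure_Type"
    "HOL-Computational_Algebra.Computational_Algebra"
    "Berlekamp_Zassenhaus.Finite_Field"
begin

hide_const (open) Divisibility.prime

text \<open>The algebraic closure of the field with \<open>CARD('p)\<close> elements, and the field of rational
  functions over it.\<close>

type_synonym 'p Fp_bar = "'p mod_ring alg_closure"
type_synonym 'p Fp_bar_t = "'p mod_ring alg_closure poly fract"

definition ratfun_var :: "'p::prime_card Fp_bar_t" where
  "ratfun_var = Fract [:0, 1:] 1"

definition is_subfield :: "'l::field set \<Rightarrow> bool" where
  "is_subfield K \<longleftrightarrow> 0 \<in> K \<and> 1 \<in> K \<and> (\<forall>x\<in>K. - x \<in> K \<and> inverse x \<in> K) \<and>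
     (\<forall>x\<in>K. \<forall>y\<in>K. x + y \<in> K \<and> x * y \<in> K)"

text \<open>In characteristic \<open>p\<close> the equation \<open>x ^ (p ^ n) = t\<close> has at most one solution, so the set
  of all solutions for all \<open>n\<close> consists of \<open>t\<close> and its iterated \<open>p\<close>-th roots, as far as these
  exist in the ambient field.\<close>

definition perfect_ratfun_field :: "('p::prime_card Fp_bar_t \<Rightarrow> 'l::field) \<Rightarrow> 'l set" where
  "perfect_ratfun_field \<iota> =
     is_subfield hull (range \<iota> \<union> {x. \<exists>n. x ^ (CARD('p) ^ n) = \<iota> ratfun_var})"

definition is_finite_extension_of :: "'l::field set \<Rightarrow> bool" where
  "is_finite_extension_of K \<longleftrightarrow>
     (\<exists>B. finite B \<and> (\<forall>x. \<exists>c. (\<forall>b\<in>B. c b \<in> K) \<and> x = (\<Sum>b\<in>B. c b * b)))"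

definition absolute_value :: "('k::field \<Rightarrow> real) \<Rightarrow> bool" where
  "absolute_value v \<longleftrightarrow>
     (\<forall>x. v x \<ge> 0) \<and> (\<forall>x. v x = 0 \<longleftrightarrow> x = 0) \<and>
     (\<forall>x y. v (x * y) = v x * v y) \<and> (\<forall>x y. v (x + y) \<le> v x + v y)"

text \<open>A place is represented by any of its absolute values; a place of \<open>L\<close> lies above some place
  of the rational function field iff the restriction is non-trivial.\<close>

definition places_above :: "('k::field \<Rightarrow> 'l::field) \<Rightarrow> ('l \<Rightarrow> real) set" where
  "places_above \<iota> = {v. absolute_value v \<and> (\<exists>x. x \<noteq> 0 \<and> v (\<iota> x) \<noteq> 1)}"

definition is_complete_extension ::
    "('l::field \<Rightarrow> real) \<Rightarrow> ('l \<Rightarrow> 'c::alg_closed_field) \<Rightarrow> ('c \<Rightarrow> real) \<Rightarrow> bool" where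
  "is_complete_extension v \<sigma> av \<longleftrightarrow>
     field_hom \<sigma> \<and> absolute_value av \<and> (\<forall>x. av (\<sigma> x) = v x) \<and>
     Metric_space.mcomplete UNIV (\<lambda>x y. av (x - y))"

text \<open>The Berkovich affine line: multiplicative seminorms on the polynomial ring extending the
  absolute value. Its topology is the one induced from the product topology on functions
  from polynomials to reals, i.e. the weakest one making all evaluations continuous.\<close>

definition berk_line :: "('c::field \<Rightarrow> real) \<Rightarrow> ('c poly \<Rightarrow> real) set" where
  "berk_line av = {x. (\<forall>f. x f \<ge> 0) \<and> (\<forall>c. x [:c:] = av c) \<and>
     (\<forall>f g. x (f * g) = x f * x g) \<and> (\<forall>f g. x (f + g) \<le> x f + x g)}"

definition type1 :: "('c::field \<Rightarrow> real) \<Rightarrow> 'c \<Rightarrow> ('c poly \<Rightarrow> real)" where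
  "type1 av c = (\<lambda>f. av (poly f c))"

text \<open>The Hsia kernel \<open>\<delta>(x, y)\<close> is the limes superior of \<open>\<bar>z - w\<bar>\<close> for \<open>z \<rightarrow> x\<close>, \<open>w \<rightarrow> y\<close> with \<open>z, w\<close>
  points of type I (Baker and Rumely, Proposition 4.1). It is finite on the Berkovich line, so
  that the conversion to a real number is harmless.\<close>

definition hsia_kernel ::
    "('c::field \<Rightarrow> real) \<Rightarrow> ('c poly \<Rightarrow> real) \<Rightarrow> ('c poly \<Rightarrow> real) \<Rightarrow> real" where
  "hsia_kernel av x y =
     real_of_ereal (Limsup (filtercomap (type1 av) (nhds x) \<times>\<^sub>F filtercomap (type1 av) (nhds y))
                           (\<lambda>(z, w). ereal (av (z - w))))"

definition neg_log :: "real \<Rightarrow> ereal" where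
  "neg_log r = (if r = 0 then \<infinity> else ereal (- ln r))"

text \<open>The Lebesgue integral of an extended real function that is bounded below: the integral of
  its positive part minus that of its negative part.\<close>

definition ereal_integral :: "'a measure \<Rightarrow> ('a \<Rightarrow> ereal) \<Rightarrow> ereal" where
  "ereal_integral \<mu> f =
     enn2ereal (\<integral>\<^sup>+ x. e2ennreal (f x) \<partial>\<mu>) - enn2ereal (\<integral>\<^sup>+ x. e2ennreal (- f x) \<partial>\<mu>)"

text \<open>Iterated rather than with respect to the product measure: the Berkovich line need not be
  second countable, and then \<open>\<delta>\<close> need not be measurable for the product sigma-algebra, whereas
  \<open>\<delta>(\<sqdot>, y)\<close> is continuous.\<close>

definition energy :: "('c::field \<Rightarrow> real) \<Rightarrow> ('c poly \<Rightarrow> real) measure \<Rightarrow> ereal" where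
  "energy av \<mu> =
     ereal_integral \<mu> (\<lambda>y. ereal_integral \<mu> (\<lambda>x. neg_log (hsia_kernel av x y)))"

definition prob_measures_on :: "'a::topological_space set \<Rightarrow> 'a measure set" where
  "prob_measures_on E = {\<mu>. prob_space \<mu> \<and> sets \<mu> = sets (restrict_space borel E)}"

definition robin_constant :: "('c::field \<Rightarrow> real) \<Rightarrow> ('c poly \<Rightarrow> real) set \<Rightarrow> ereal" where
  "robin_constant av E = (INF \<mu>\<in>prob_measures_on E. energy av \<mu>)"

text \<open>\<open>e\<^sup>-\<^sup>V\<close> with the usual conventions at the infinite values of \<open>V\<close>.\<close>

definition log_capacity :: "('c::field \<Rightarrow> real) \<Rightarrow> ('c poly \<Rightarrow> real) set \<Rightarrow> ereal" where
  "log_capacity av E =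
     (case robin_constant av E of ereal r \<Rightarrow> ereal (exp (- r)) | PInfty \<Rightarrow> 0 | MInfty \<Rightarrow> \<infinity>)"

definition log_plus :: "real \<Rightarrow> real" where
  "log_plus z = ln (max z 1)"

definition unicritical :: "nat \<Rightarrow> 'c::field \<Rightarrow> 'c \<Rightarrow> 'c" where
  "unicritical d c x = x ^ d + c"

definition local_height :: "('c::field \<Rightarrow> real) \<Rightarrow> nat \<Rightarrow> 'c \<Rightarrow> 'c \<Rightarrow> real" where
  "local_height av d g c = lim (\<lambda>n. log_plus (av ((unicritical d c ^^ n) g)) / real d ^ n)"

text \<open>The continuous extension of \<open>c \<mapsto> local_height av d g c\<close> from the points of type I to the
  Berkovich line. Only the values on \<open>berk_line av\<close> are meaningful; there the extension is
  unique if the absolute value is non-trivial, as the points of type I are then dense.\<close>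

definition berk_height ::
    "('c::field \<Rightarrow> real) \<Rightarrow> nat \<Rightarrow> 'c \<Rightarrow> ('c poly \<Rightarrow> real) \<Rightarrow> real" where
  "berk_height av d g =
     (SOME H. continuous_on (berk_line av) H \<and> (\<forall>c. H (type1 av c) = local_height av d g c))"

definition mandelbrot :: "('c::field \<Rightarrow> real) \<Rightarrow> nat \<Rightarrow> 'c \<Rightarrow> ('c poly \<Rightarrow> real) set" where
  "mandelbrot av d g = {x \<in> berk_line av. berk_height av d g x = 0}"

end

theory Submission
  imports Defs "HOL-Combinatorics.Permutations"
begin

text \<open>
  Write \<open>F\<^sub>n\<close> for the polynomial \<open>\<lambda> \<mapsto> f\<^sub>\<lambda>\<^sup>n(\<gamma>)\<close> and \<open>R = max 1 \<bar>\<gamma>\<bar>\<close>. If \<open>\<bar>F\<^sub>n\<bar> > R\<close> at a point, then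
  \<open>\<bar>F\<^sub>n\<^sub>+\<^sub>1\<bar> = \<bar>F\<^sub>n\<bar>\<^sup>d\<close> there, so the Mandelbrot set is the decreasing intersection of the lemniscates
  \<open>\<bar>F\<^sub>n\<bar> \<le> R\<close>. Each of these is a finite union of discs. As \<open>F\<^sub>n\<close> is monic of degree \<open>N = d\<^sup>n\<^sup>-\<^sup>1\<close>, giving every
  disc the proportion of zeros of \<open>F\<^sub>n\<close> in it yields a measure with constant potential \<open>- ln R / N\<close>
  on the lemniscate. The ultrametric logarithmic kernel is conditionally positive definite, so this measure has
  minimal energy and the Robin constant of the Mandelbrot set is at least \<open>- ln R / N \<rightarrow> 0\<close>. Conversely,
  a disc of one level contains \<open>d\<close> times as many zeros of the next polynomial. The measures are thus compatible
  and define a measure on the paths in the tree of discs. Sending a path to the limit of its discs transports it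
  to a measure on the Mandelbrot set, whose potential is nonpositive by monotone convergence.
\<close>

section \<open>Seminorms on the polynomial ring\<close>

text \<open>The Berkovich line over \<open>'c\<close> need not be metrizable or second countable,
  and decreasing discs in \<open>'c\<close> may have empty intersection. Weak limits of the level
  measures are therefore avoided: the limit measure is the image of Lebesgue measure on the unit
  interval, and potentials and energies are reduced to finite levels. This works because the Hsia
  kernel is bounded above by the distance of level-n discs, a kernel with finitely many values, and
  below by the infimum of these distances along a path. The threshold R is at least
  \<open>\<bar>\<gamma>\<bar>\<close> so that a parameter larger than the d-th power of R dominates
  the first iterate, and at least 1 so that d-th powers increase absolute values above R. The strong
  triangle inequality is not part of \<open>absolute_value\<close>; it is extracted from
  Frobenius.\<close>

locale nonarch_field =
  fixes av :: "'c::alg_closed_field \<Rightarrow> real"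
  assumes absolute_value: "absolute_value av"
    and prime_char: "prime CHAR('c)"
    and nontrivial: "\<exists>c. c \<noteq> 0 \<and> av c \<noteq> 1"

abbreviation lin :: "'c::comm_ring_1 \<Rightarrow> 'c poly" where
  "lin a \<equiv> [:- a, 1:]"

lemma poly_lin_induct [case_names const lin]:
  fixes f :: "'c::alg_closed_field poly"
  assumes const: "\<And>c. Q [:c:]" and lin: "\<And>a f. Q f \<Longrightarrow> Q (lin a * f)"
  shows "Q f"
proof (induction "Polynomial.degree f" arbitrary: f)
  case 0
  then show ?case using const by (metis degree_eq_zeroE)
next
  case (Suc n)
  then obtain a where "poly f a = 0"
    using alg_closed_imp_poly_has_root[of f] by auto
  then obtain g where g: "f = lin a * g"
    using poly_eq_0_iff_dvd by (metis dvdE)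
  with Suc.hyps(2) have "g \<noteq> 0" by auto
  then have "Polynomial.degree f = Suc (Polynomial.degree g)" by (simp only: g, subst degree_mult_eq) auto
  with Suc.hyps have "Q g" by simp
  then show ?case using lin g by simp
qed

text \<open>If \<open>a > b > 0\<close>, large powers of \<open>a / b\<close> exceed 2, so the
  factor 2 disappears under roots. The exponents are \<open>p ^ n\<close> because Frobenius supplies
  exactly these.\<close>

lemma le_of_power_le_double:
  fixes a b :: real
  assumes "p > (1::nat)" "a \<ge> 0" "b \<ge> 0" "\<And>n. a ^ (p ^ n) \<le> 2 * b ^ (p ^ n)"
  shows "a \<le> b"
proof (rule ccontr)
  assume "\<not> a \<le> b"
  then have ab: "a > b" by simp
  show False
  proof (cases "b = 0")
    case True
    then show ?thesis using assms(4)[of 0] ab by simp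
  next
    case False
    then have b: "b > 0" using assms by simp
    then have "a / b > 1" using ab by simp
    then obtain n where n: "(a / b) ^ n > 2"
      using real_arch_pow by blast
    have "n \<le> p ^ n" using assms(1) by (simp add: less_imp_le_nat less_exp)
    then have "(a / b) ^ n \<le> (a / b) ^ (p ^ n)"
      using \<open>a / b > 1\<close> by (intro power_increasing) auto
    with n have "(a / b) ^ (p ^ n) > 2" by simp
    then show ?thesis using assms(4)[of n] b by (simp add: power_divide field_simps)
  qed
qed

context nonarch_field
begin

lemma av_nonneg [simp]: "av x \<ge> 0"
  and av_eq_0_iff [simp]: "av x = 0 \<longleftrightarrow> x = 0"
  and av_mult: "av (x * y) = av x * av y"
  and av_triangle: "av (x + y) \<le> av x + av y"
  using absolute_value by (auto simp: absolute_value_def)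

lemma av_1 [simp]: "av 1 = 1"
  using av_mult[of 1 1] av_eq_0_iff[of 1] by auto

lemma av_0 [simp]: "av 0 = 0"
  by simp

lemma av_power: "av (x ^ n) = av x ^ n"
  by (induction n) (auto simp: av_mult)

lemma av_minus [simp]: "av (- x) = av x"
proof -
  have "av (-1) ^ 2 = 1" using av_mult[of "-1" "-1"] by (simp add: power2_eq_square)
  then have "av (-1) = 1" by (metis av_nonneg power2_eq_1_iff neg_0_le_iff_le not_one_le_zero)
  then show ?thesis using av_mult[of "-1" x] by simp
qed

lemma av_minus_commute: "av (x - y) = av (y - x)"
  using av_minus[of "x - y"] by simp

lemma char_gt_1: "CHAR('c) > 1"
  using prime_char prime_gt_1_nat by blast

section \<open>The strong triangle inequality at points of the Berkovich line\<close>

context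
  fixes x :: "'c poly \<Rightarrow> real"
  assumes x: "x \<in> berk_line av"
begin

lemma berk_nonneg: "x f \<ge> 0"
  and berk_const: "x [:c:] = av c"
  and berk_mult: "x (f * g) = x f * x g"
  and berk_triangle: "x (f + g) \<le> x f + x g"
  using x by (auto simp: berk_line_def)

lemma berk_1: "x 1 = 1"
  using berk_const[of 1] by (simp add: one_pCons)

lemma berk_power: "x (f ^ n) = x f ^ n"
  by (induction n) (auto simp: berk_mult berk_1)

lemma berk_prod: "x (\<Prod>i\<in>I. f i) = (\<Prod>i\<in>I. x (f i))"
  by (induction I rule: infinite_finite_induct) (auto simp: berk_mult berk_1)

lemma berk_minus: "x (- f) = x f"
proof -
  have "- f = [:-1:] * f" by simp
  then show ?thesis using berk_mult[of "[:-1:]" f] by (simp add: berk_const)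
qed

text \<open>Raising to the power \<open>CHAR('c) ^ n\<close> is additive, so the ordinary triangle
  inequality bounds that power of \<open>x (f + g)\<close> by twice the power of the maximum, for
  every \<open>n\<close>.\<close>

lemma berk_add_le_max: "x (f + g) \<le> max (x f) (x g)"
proof (rule le_of_power_le_double[OF char_gt_1])
  fix n
  let ?q = "CHAR('c) ^ n"
  have "(f + g) ^ ?q = f ^ ?q + g ^ ?q"
    by (rule freshmans_dream') (use prime_char in auto)
  then have "x (f + g) ^ ?q = x (f ^ ?q + g ^ ?q)" by (metis berk_power)
  also have "\<dots> \<le> x f ^ ?q + x g ^ ?q" using berk_triangle by (metis berk_power)
  also have "\<dots> \<le> max (x f) (x g) ^ ?q + max (x f) (x g) ^ ?q"
    by (intro add_mono power_mono) (auto simp: berk_nonneg)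
  finally show "x (f + g) ^ ?q \<le> 2 * max (x f) (x g) ^ ?q" by simp
qed (auto simp: le_max_iff_disj berk_nonneg)

lemma berk_add_eq_max:
  assumes "x f \<noteq> x g"
  shows "x (f + g) = max (x f) (x g)"
proof -
  have "x f \<le> max (x (f + g)) (x g)" using berk_add_le_max[of "f + g" "- g"] by (simp add: berk_minus)
  moreover have "x g \<le> max (x (f + g)) (x f)" using berk_add_le_max[of "f + g" "- f"] by (simp add: berk_minus)
  ultimately show ?thesis using assms berk_add_le_max[of f g] by linarith
qed

text \<open>With \<open>x (lin a)\<close> read as the distance from the point \<open>x\<close> to
  \<open>a\<close>, this and the next two facts are the strong triangle inequality and the isosceles
  principle for \<open>x\<close>, \<open>a\<close>, \<open>b\<close>.\<close>

lemma berk_lin_le: "x (lin a) \<le> max (x (lin b)) (av (a - b))"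
proof -
  have "lin a = lin b + [:b - a:]" by simp
  then show ?thesis using berk_add_le_max[of "lin b" "[:b - a:]"] by (simp add: av_minus_commute berk_const)
qed

lemma berk_lin_diff_le: "av (a - b) \<le> max (x (lin a)) (x (lin b))"
proof -
  have "[:a - b:] = lin b + - lin a" by simp
  then have "av (a - b) \<le> max (x (lin b)) (x (- lin a))"
    using berk_add_le_max[of "lin b" "- lin a"] by (metis berk_const)
  then show ?thesis by (simp only: berk_minus max.commute)
qed

lemma berk_lin_eq:
  assumes "x (lin b) < av (a - b)"
  shows "x (lin a) = av (a - b)"
  using berk_lin_le[of a b] berk_lin_diff_le[of a b] assms by linarith

end

section \<open>Classical points, density of the values and points of discs\<close>

lemma type1_in_berk [simp]: "type1 av c \<in> berk_line av"
  by (auto simp: type1_def berk_line_def av_mult av_triangle)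

lemma type1_lin [simp]: "type1 av c (lin a) = av (c - a)"
  by (simp add: type1_def)

lemma av_add_le_max: "av (a + b) \<le> max (av a) (av b)"
  using berk_add_le_max[OF type1_in_berk, of 0 "[:a:]" "[:b:]"] by (simp add: type1_def)

lemma av_add_eq_max: "av a \<noteq> av b \<Longrightarrow> av (a + b) = max (av a) (av b)"
  using berk_add_eq_max[OF type1_in_berk, of 0 "[:a:]" "[:b:]"] by (simp add: type1_def)

lemma av_ultra: "av (a - c) \<le> max (av (a - b)) (av (b - c))"
  using av_add_le_max[of "a - b" "b - c"] by simp

lemma av_diff_eq_max: "av a \<noteq> av b \<Longrightarrow> av (a - b) = max (av a) (av b)"
  using av_add_eq_max[of a "- b"] by simp

text \<open>Roots of any order exist, so some values exceed 1 by arbitrarily little, and the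
  integral powers of such a value cannot jump over the interval from \<open>s\<close> to
  \<open>t\<close>.\<close>

lemma value_dense:
  assumes "0 \<le> s" "s < t"
  shows "\<exists>z. s < av z \<and> av z < t"
proof -
  obtain c0 where c0: "c0 \<noteq> 0" "av c0 \<noteq> 1" using nontrivial by blast
  obtain c where c: "av c > 1"
  proof (cases "av c0 > 1")
    case False
    then have "av c0 < 1" "av c0 > 0" using c0 by (auto simp: less_le)
    moreover have "av (inverse c0) * av c0 = 1"
      using c0 by (simp flip: av_mult)
    then have "av (inverse c0) = 1 / av c0" using c0 by (simp add: field_simps)
    ultimately have "av (inverse c0) > 1" by simp
    then show ?thesis using that by blast
  qed (use that in blast)
  define s' where "s' = max s (t / 2)"
  have s': "s' > 0" "s' < t" "s \<le> s'" using assms by (auto simp: s'_def)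
  then have "t / s' > 1" by simp
  then obtain m where m: "(t / s') ^ m > av c" using real_arch_pow by blast
  have "m > 0" using m c by (cases m) auto
  then obtain z where z: "z ^ m = c" using nth_root_exists by blast
  have zm: "av z ^ m = av c" using z av_power by metis
  have z1: "av z > 1"
    using zm c power_le_one[of "av z" m] by (cases "av z > 1") auto
  have zt: "av z < t / s'"
  proof (rule power_less_imp_less_base)
    show "av z ^ m < (t / s') ^ m" using m zm by simp
  qed (use \<open>t / s' > 1\<close> in simp)
  \<comment> \<open>The exponent \<open>k\<close> is the least integer for which the power of
    \<open>av z\<close> exceeds \<open>s'\<close>; since \<open>av z < t / s'\<close>, this power is
    still below \<open>t\<close>.\<close>
  define l where "l = log (av z) s'"
  define k where "k = \<lfloor>l\<rfloor> + 1"
  have zk: "av (z powi k) = av z powr (of_int k)"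
  proof (cases "k \<ge> 0")
    case True
    then show ?thesis using z1 by (simp add: power_int_def av_power powr_realpow flip: powr_realpow)
  next
    case False
    have inv: "av (inverse z) = inverse (av z)"
    proof -
      have "z \<noteq> 0" using z1 by auto
      then have "av z * av (inverse z) = 1" by (simp flip: av_mult)
      then show ?thesis by (metis inverse_unique)
    qed
    have "av (z powi k) = inverse (av z) ^ nat (- k)"
      using False by (simp add: power_int_def av_power inv)
    also have "\<dots> = av z powr (of_int k)"
      using z1 False by (simp add: powr_realpow[symmetric] power_inverse powr_minus[symmetric])
    finally show ?thesis .
  qed
  have sl: "s' = av z powr l" using s' z1 by (simp add: l_def)
  have "s' < av z powr (of_int k)"
    unfolding sl using z1 by (simp add: k_def)
  moreover have "av z powr (of_int k) \<le> av z powr (l + 1)"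
    using z1 by (simp add: k_def)
  then have "av z powr (of_int k) \<le> s' * av z"
    using z1 sl by (simp add: powr_add)
  then have "av z powr (of_int k) < t"
    using zt s' by (simp add: pos_less_divide_eq mult.commute)
  ultimately show ?thesis using zk s' by (metis le_less_trans)
qed

text \<open>A pointwise limit of multiplicative seminorms is one again, and by factorisation into
  linear polynomials convergence need only be tested on these.\<close>

lemma berk_tendstoI:
  assumes "x \<in> berk_line av" "\<And>i. y i \<in> berk_line av"
    and "\<And>a. ((\<lambda>i. y i (lin a)) \<longlongrightarrow> x (lin a)) F"
  shows "((\<lambda>i. y i f) \<longlongrightarrow> x f) F"
proof (induction f rule: poly_lin_induct)
  case (const c)
  then show ?case by (simp add: berk_const assms(1,2))
next
  case (lin a f)
  then show ?case
    using assms(3)[of a] by (simp add: berk_mult assms(1,2) tendsto_mult del: mult_pCons_left)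
qed

lemma berk_limit_exists:
  assumes "F \<noteq> bot" "\<And>i. y i \<in> berk_line av"
    and "\<And>a. ((\<lambda>i. y i (lin a)) \<longlongrightarrow> l a) F"
  shows "\<exists>x\<in>berk_line av. (\<forall>a. x (lin a) = l a)"
proof -
  have "\<exists>L. ((\<lambda>i. y i f) \<longlongrightarrow> L) F" for f
  proof (induction f rule: poly_lin_induct)
    case (const c)
    then show ?case by (auto simp: berk_const assms(2))
  next
    case (lin a f)
    then obtain L where "((\<lambda>i. y i f) \<longlongrightarrow> L) F" by blast
    then have "((\<lambda>i. y i (lin a * f)) \<longlongrightarrow> l a * L) F"
      using assms(3)[of a] by (simp add: berk_mult assms(2) tendsto_mult del: mult_pCons_left)
    then show ?case by blast
  qed
  then obtain x where x: "\<And>f. ((\<lambda>i. y i f) \<longlongrightarrow> x f) F" by metis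
  have "x \<in> berk_line av"
    unfolding berk_line_def
  proof (safe, goal_cases)
    case (1 f)
    show ?case by (rule tendsto_lowerbound[OF x _ assms(1)]) (simp add: berk_nonneg assms(2))
  next
    case (2 c)
    show ?case using tendsto_unique[OF assms(1) x[of "[:c:]"], of "av c"] by (simp add: berk_const assms(2))
  next
    case (3 f g)
    have "((\<lambda>i. y i (f * g)) \<longlongrightarrow> x f * x g) F"
      by (simp add: berk_mult assms(2) tendsto_mult x)
    then show ?case using tendsto_unique[OF assms(1) x] by blast
  next
    case (4 f g)
    show ?case
      by (rule tendsto_le[OF assms(1) tendsto_add[OF x[of f] x[of g]] x])
         (simp add: assms(2) berk_triangle)
  qed
  moreover have "x (lin a) = l a" for a
    using tendsto_unique[OF assms(1) x assms(3)] .
  ultimately show ?thesis by blast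
qed

lemma berk_mono:
  assumes "x \<in> berk_line av" "y \<in> berk_line av" "\<And>a. x (lin a) \<le> y (lin a)"
  shows "x f \<le> y f"
proof (induction f rule: poly_lin_induct)
  case (lin a f)
  then show ?case
    using assms by (simp add: berk_mult mult_mono berk_nonneg del: mult_pCons_left)
qed (simp add: berk_const assms(1,2))

text \<open>The seminorm is a limit of classical points \<open>a + z k\<close> with
  \<open>av (z k)\<close> tending to \<open>r\<close> strictly from above. Strictness excludes
  cancellation when \<open>av (a - b) = r\<close>, and multiplicativity is inherited from the
  classical points. Density of the values admits every real radius.\<close>

lemma disc_point_exists:
  assumes "r \<ge> 0"
  shows "\<exists>x\<in>berk_line av. \<forall>b. x (lin b) = max r (av (a - b))"
proof -
  have "\<exists>z. r < av z \<and> av z < r + 1 / real (Suc k)" for k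
    using assms by (intro value_dense) auto
  then obtain z where z: "\<And>k. r < av (z k)" "\<And>k. av (z k) < r + 1 / real (Suc k)" by metis
  have zr: "(\<lambda>k. av (z k)) \<longlonglongrightarrow> r"
  proof (rule tendsto_sandwich)
    show "\<forall>\<^sub>F k in sequentially. r \<le> av (z k)" using z by (simp add: less_imp_le)
    show "\<forall>\<^sub>F k in sequentially. av (z k) \<le> r + 1 / real (Suc k)" using z by (simp add: less_imp_le)
    have "(\<lambda>k. r + 1 / real (Suc k)) \<longlonglongrightarrow> r + 0"
      by (intro tendsto_intros) (use LIMSEQ_inverse_real_of_nat in \<open>simp add: inverse_eq_divide\<close>)
    then show "(\<lambda>k. r + 1 / real (Suc k)) \<longlonglongrightarrow> r" by simp
  qed auto
  have "(\<lambda>k. type1 av (a + z k) (lin b)) \<longlonglongrightarrow> max r (av (a - b))" for b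
  proof -
    have ev: "\<forall>\<^sub>F k in sequentially. max (av (z k)) (av (a - b)) = type1 av (a + z k) (lin b)"
    proof (cases "av (a - b) \<le> r")
      case True
      have "type1 av (a + z k) (lin b) = max (av (z k)) (av (a - b))" for k
        using av_add_eq_max[of "z k" "a - b"] z(1)[of k] True by (simp add: algebra_simps)
      then show ?thesis by simp
    next
      case False
      then have "\<forall>\<^sub>F k in sequentially. av (z k) < av (a - b)"
        using order_tendstoD(2)[OF zr, of "av (a - b)"] by simp
      then show ?thesis
      proof eventually_elim
        case (elim k)
        then show ?case using av_add_eq_max[of "z k" "a - b"] by (simp add: algebra_simps)
      qed
    qed
    have "(\<lambda>k. max (av (z k)) (av (a - b))) \<longlonglongrightarrow> max r (av (a - b))"
      by (intro tendsto_max zr tendsto_const)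
    then show ?thesis using ev by (rule Lim_transform_eventually)
  qed
  from berk_limit_exists[where y = "\<lambda>k. type1 av (a + z k)", OF _ _ this] show ?thesis by simp
qed

text \<open>The point of the closed disc with centre \<open>a\<close> and radius \<open>r\<close>,
  classical for \<open>r = 0\<close> and of type II or III otherwise. Its values on linear
  polynomials determine it.\<close>

definition disc_point :: "'c \<Rightarrow> real \<Rightarrow> 'c poly \<Rightarrow> real" where
  "disc_point a r = (SOME x. x \<in> berk_line av \<and> (\<forall>b. x (lin b) = max r (av (a - b))))"

lemma disc_point:
  assumes "r \<ge> 0"
  shows disc_point_in_berk: "disc_point a r \<in> berk_line av"
    and disc_point_lin: "disc_point a r (lin b) = max r (av (a - b))"
  using someI_ex[of "\<lambda>x. x \<in> berk_line av \<and> (\<forall>b. x (lin b) = max r (av (a - b)))"]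
    disc_point_exists[OF assms, of a] unfolding disc_point_def by blast+

end

section \<open>The Hsia kernel\<close>

lemma tendsto_fun_iff:
  fixes f :: "'i \<Rightarrow> 'a \<Rightarrow> 'b::topological_space"
  shows "(f \<longlongrightarrow> l) F \<longleftrightarrow> (\<forall>a. ((\<lambda>i. f i a) \<longlongrightarrow> l a) F)"
  using limitin_componentwise[of "\<lambda>_. euclidean :: 'b topology" UNIV f l F]
  by (simp add: euclidean_product_topology limitin_canonical_iff)

lemma eventually_nhds_coordinate:
  fixes x :: "'a \<Rightarrow> 'b::topological_space"
  assumes "open U" "x a \<in> U"
  shows "\<forall>\<^sub>F y in nhds x. y a \<in> U"
proof -
  have "open ((\<lambda>y :: 'a \<Rightarrow> 'b. y a) -` U)"
    using assms(1) continuous_on_product_coordinates by (rule open_vimage)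
  then show ?thesis using assms(2) by (auto simp: eventually_nhds)
qed

text \<open>The line need not be first countable, so classical points approaching a given point are
  indexed by a finite set of centres and a tolerance instead of a natural number.\<close>

definition approx_filter :: "('a set \<times> real) filter" where
  "approx_filter = finite_subsets_at_top UNIV \<times>\<^sub>F at_right 0"

lemma approx_filter_neq_bot [simp]: "approx_filter \<noteq> bot"
  by (simp add: approx_filter_def prod_filter_eq_bot)

lemma eventually_approx_filter:
  assumes "e > 0" "\<And>A \<epsilon>. finite A \<Longrightarrow> a \<in> A \<Longrightarrow> 0 < \<epsilon> \<Longrightarrow> \<epsilon> < e \<Longrightarrow> P (A, \<epsilon>)"
  shows "eventually P approx_filter"
  unfolding approx_filter_def eventually_prod_filter
proof (intro exI conjI allI impI)
  show "\<forall>\<^sub>F A in finite_subsets_at_top UNIV. finite A \<and> a \<in> A"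
    unfolding eventually_finite_subsets_at_top by (intro exI[of _ "{a}"]) auto
  show "\<forall>\<^sub>F \<epsilon> in at_right 0. 0 < \<epsilon> \<and> \<epsilon> < e"
    using assms(1) by (auto simp: eventually_at_right_field)
qed (use assms(2) in auto)

context nonarch_field
begin

lemma berk_tendsto:
  assumes "x \<in> berk_line av" "\<And>i. y i \<in> berk_line av"
    and "\<And>a. ((\<lambda>i. y i (lin a)) \<longlongrightarrow> x (lin a)) F"
  shows "(y \<longlongrightarrow> x) F"
  unfolding tendsto_fun_iff using berk_tendstoI[OF assms] by blast

text \<open>Only the distances to the closest point of \<open>A\<close> need to be perturbed; the values excluded by
  \<open>B\<close> make later applications of the ultrametric inequality sharp.\<close>

lemma generic_near:
  assumes x: "x \<in> berk_line av" and A: "finite A" "A \<noteq> {}" and "finite B" "\<epsilon> > 0"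
  shows "\<exists>i\<in>A. \<exists>z. av z \<notin> B \<and> \<bar>av z - x (lin i)\<bar> < \<epsilon> \<and>
           (\<forall>a\<in>A. \<bar>av (i + z - a) - x (lin a)\<bar> < \<epsilon>)"
proof -
  define i where "i = arg_min_on (\<lambda>a. x (lin a)) A"
  have i: "i \<in> A" "\<And>a. a \<in> A \<Longrightarrow> x (lin i) \<le> x (lin a)"
    unfolding i_def using A by (auto intro: arg_min_if_finite arg_min_least)
  define \<rho> where "\<rho> = x (lin i)"
  \<comment> \<open>The open interval from \<open>\<rho>\<close> to \<open>t\<close> contains no
    value from \<open>B'\<close>. Choosing \<open>av z\<close> there avoids \<open>B\<close> and
    prevents cancellation between \<open>z\<close> and \<open>i - a\<close>.\<close>
  define B' where "B' = B \<union> (\<lambda>a. av (i - a)) ` A"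
  define t where "t = Min (insert (\<rho> + \<epsilon>) {b \<in> B'. b > \<rho>})"
  have finB: "finite {b \<in> B'. b > \<rho>}" using assms by (simp add: B'_def)
  have "\<rho> < t" using finB \<open>\<epsilon> > 0\<close> by (simp add: t_def)
  moreover have "0 \<le> \<rho>" using berk_nonneg[OF x] by (simp add: \<rho>_def)
  ultimately obtain z where z: "\<rho> < av z" "av z < t" using value_dense by blast
  have "t \<le> \<rho> + \<epsilon>" using finB by (simp add: t_def)
  have notB: "av z \<notin> B'"
  proof
    assume "av z \<in> B'"
    then have "t \<le> av z" unfolding t_def using finB z by (intro Min_le) auto
    then show False using z by simp
  qed
  have "\<bar>av (i + z - a) - x (lin a)\<bar> < \<epsilon>" if a: "a \<in> A" for a
  proof -
    have "x (lin a) = max \<rho> (av (i - a))"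
      using i(2)[OF a] berk_lin_le[OF x, of a i] berk_lin_diff_le[OF x, of i a]
      unfolding \<rho>_def by (simp add: av_minus_commute[of a i])
    moreover have "av z \<noteq> av (i - a)" using notB a by (auto simp: B'_def)
    then have "av (z + (i - a)) = max (av z) (av (i - a))" by (rule av_add_eq_max)
    then have "av (i + z - a) = max (av z) (av (i - a))" by (simp add: algebra_simps)
    ultimately show ?thesis using z \<open>t \<le> \<rho> + \<epsilon>\<close> \<open>\<epsilon> > 0\<close> by (simp add: max_def)
  qed
  then show ?thesis using i(1) notB z \<open>t \<le> \<rho> + \<epsilon>\<close>
    by (intro bexI[of _ i] exI[of _ z]) (auto simp: B'_def \<rho>_def)
qed

text \<open>The radius of the smallest disc containing both points, in terms of values on linear
  polynomials. The infimum need not be attained, for instance at a point of type IV paired with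
  itself.\<close>

definition hsia_inf :: "('c poly \<Rightarrow> real) \<Rightarrow> ('c poly \<Rightarrow> real) \<Rightarrow> real" where
  "hsia_inf x y = (INF a. max (x (lin a)) (y (lin a)))"

lemma hsia_inf_bdd:
  assumes "x \<in> berk_line av"
  shows "bdd_below (range (\<lambda>a. max (x (lin a)) (y (lin a))))"
  using berk_nonneg[OF assms] by (intro bdd_belowI[of _ 0]) (auto simp: le_max_iff_disj)

lemma hsia_inf_le:
  assumes "x \<in> berk_line av"
  shows "hsia_inf x y \<le> max (x (lin a)) (y (lin a))"
  unfolding hsia_inf_def by (rule cINF_lower[OF hsia_inf_bdd[OF assms]]) simp

lemma hsia_inf_ge:
  assumes "\<And>a. c \<le> max (x (lin a)) (y (lin a))"
  shows "c \<le> hsia_inf x y"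
  unfolding hsia_inf_def using assms by (intro cINF_greatest) auto

text \<open>Separate approximations could coincide, for instance if \<open>x = y\<close>. So
  \<open>w\<close> is chosen second, at a distance from its centre \<open>k\<close> that differs
  from \<open>av (z - k)\<close>; then \<open>av (z - w)\<close> is the maximum of two numbers close
  to \<open>x (lin k)\<close> and \<open>y (lin k)\<close>.\<close>

lemma generic_pair:
  assumes x: "x \<in> berk_line av" and y: "y \<in> berk_line av" and A: "finite A" "A \<noteq> {}" and "\<epsilon> > 0"
  shows "\<exists>z w. (\<forall>a\<in>A. \<bar>av (z - a) - x (lin a)\<bar> < \<epsilon>) \<and> (\<forall>a\<in>A. \<bar>av (w - a) - y (lin a)\<bar> < \<epsilon>) \<and>
           hsia_inf x y - \<epsilon> < av (z - w)"
proof -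
  obtain z where z: "\<forall>a\<in>A. \<bar>av (z - a) - x (lin a)\<bar> < \<epsilon>"
    using generic_near[OF x A, of "{}" \<epsilon>] \<open>\<epsilon> > 0\<close> by auto
  obtain k w where k: "k \<in> A" and w: "av w \<notin> (\<lambda>a. av (z - a)) ` A" "\<bar>av w - y (lin k)\<bar> < \<epsilon>"
    "\<forall>a\<in>A. \<bar>av (k + w - a) - y (lin a)\<bar> < \<epsilon>"
    using generic_near[OF y A, of "(\<lambda>a. av (z - a)) ` A" \<epsilon>] \<open>\<epsilon> > 0\<close> A(1) by blast
  have "av (z - k) \<noteq> av w" using w(1) k by (metis imageI)
  then have "av (z - (k + w)) = max (av (z - k)) (av w)"
    using av_diff_eq_max[of "z - k" w] by (simp add: algebra_simps)
  moreover have "\<bar>av (z - k) - x (lin k)\<bar> < \<epsilon>" using z k by blast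
  ultimately have "hsia_inf x y - \<epsilon> < av (z - (k + w))"
    using hsia_inf_le[OF x, of y k] w(2) by linarith
  then show ?thesis using z w(3) by blast
qed

lemma approx_net:
  assumes x: "x \<in> berk_line av" and y: "y \<in> berk_line av"
  shows "\<exists>z w :: 'c set \<times> real \<Rightarrow> 'c. ((\<lambda>i. type1 av (z i)) \<longlongrightarrow> x) approx_filter \<and> ((\<lambda>i. type1 av (w i)) \<longlongrightarrow> y) approx_filter \<and>
           (\<forall>e>0. \<forall>\<^sub>F i in approx_filter. hsia_inf x y - e < av (z i - w i))"
proof -
  define Q where "Q = (\<lambda>(A, \<epsilon>) (z, w). (\<forall>a\<in>A. \<bar>av (z - a) - x (lin a)\<bar> < \<epsilon>) \<and>
    (\<forall>a\<in>A. \<bar>av (w - a) - y (lin a)\<bar> < \<epsilon>) \<and> hsia_inf x y - \<epsilon> < av (z - w))"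
  have "\<exists>zw. finite (fst i) \<and> fst i \<noteq> {} \<and> snd i > 0 \<longrightarrow> Q i zw" for i
    using generic_pair[OF x y, of "fst i" "snd i"] by (cases i) (fastforce simp: Q_def)
  then obtain zw where zw: "\<And>i. finite (fst i) \<and> fst i \<noteq> {} \<and> snd i > 0 \<longrightarrow> Q i (zw i)" by metis
  have Q: "Q (A, \<epsilon>) (fst (zw (A, \<epsilon>)), snd (zw (A, \<epsilon>)))" if "finite A" "a \<in> A" "\<epsilon> > 0" for A \<epsilon> a
    using zw[of "(A, \<epsilon>)"] that by auto
  define z w where "z = fst \<circ> zw" and "w = snd \<circ> zw"
  have ev: "\<forall>\<^sub>F i in approx_filter. \<bar>av (z i - a) - x (lin a)\<bar> < e \<and> \<bar>av (w i - a) - y (lin a)\<bar> < e \<and>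
      hsia_inf x y - e < av (z i - w i)" if "e > 0" for a e
  proof (rule eventually_approx_filter[where a = a, OF that])
    fix A \<epsilon> assume "finite A" "a \<in> A" "0 < \<epsilon>" "\<epsilon> < e"
    with Q[OF this(1,2,3)] show "\<bar>av (z (A, \<epsilon>) - a) - x (lin a)\<bar> < e \<and>
      \<bar>av (w (A, \<epsilon>) - a) - y (lin a)\<bar> < e \<and> hsia_inf x y - e < av (z (A, \<epsilon>) - w (A, \<epsilon>))"
      unfolding Q_def z_def w_def by force
  qed
  have z: "((\<lambda>i. type1 av (z i)) \<longlongrightarrow> x) approx_filter"
  proof (rule berk_tendsto[OF x])
    fix a show "((\<lambda>i. type1 av (z i) (lin a)) \<longlongrightarrow> x (lin a)) approx_filter"
      unfolding tendsto_iff dist_real_def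
    proof (intro allI impI)
      fix e :: real assume "e > 0"
      from ev[OF this, of a] show "\<forall>\<^sub>F i in approx_filter. \<bar>type1 av (z i) (lin a) - x (lin a)\<bar> < e"
        by eventually_elim simp
    qed
  qed simp
  have w: "((\<lambda>i. type1 av (w i)) \<longlongrightarrow> y) approx_filter"
  proof (rule berk_tendsto[OF y])
    fix a show "((\<lambda>i. type1 av (w i) (lin a)) \<longlongrightarrow> y (lin a)) approx_filter"
      unfolding tendsto_iff dist_real_def
    proof (intro allI impI)
      fix e :: real assume "e > 0"
      from ev[OF this, of a] show "\<forall>\<^sub>F i in approx_filter. \<bar>type1 av (w i) (lin a) - y (lin a)\<bar> < e"
        by eventually_elim simp
    qed
  qed simp
  have e: "\<forall>\<^sub>F i in approx_filter. hsia_inf x y - e < av (z i - w i)" if "e > 0" for e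
    using ev[OF that, of 0] by eventually_elim simp
  show ?thesis by (intro exI[of _ z] exI[of _ w] conjI allI impI) (use z w e in auto)
qed

lemma hsia_kernel_eq:
  assumes x: "x \<in> berk_line av" and y: "y \<in> berk_line av"
  shows "hsia_kernel av x y = hsia_inf x y"
proof -
  let ?F = "filtercomap (type1 av) (nhds x) \<times>\<^sub>F filtercomap (type1 av) (nhds y)"
  let ?f = "\<lambda>(z, w). ereal (av (z - w))"
  have upper: "Limsup ?F ?f \<le> ereal (max (x (lin a)) (y (lin a)))" for a
    unfolding Limsup_le_iff
  proof (intro allI impI)
    fix c assume c: "ereal (max (x (lin a)) (y (lin a))) < c"
    obtain t where t: "max (x (lin a)) (y (lin a)) < t" "ereal t < c"
      using ereal_dense2[OF c] by auto
    have "\<forall>\<^sub>F z in filtercomap (type1 av) (nhds u). av (z - a) < t" if "u (lin a) < t" for u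
    proof -
      have "\<forall>\<^sub>F y in nhds u. y (lin a) \<in> {..<t}"
        using that by (intro eventually_nhds_coordinate) auto
      then have "\<forall>\<^sub>F z in filtercomap (type1 av) (nhds u). type1 av z (lin a) \<in> {..<t}"
        by (rule eventually_filtercomapI)
      then show ?thesis by simp
    qed
    then have "\<forall>\<^sub>F z in filtercomap (type1 av) (nhds x). av (z - a) < t"
      "\<forall>\<^sub>F w in filtercomap (type1 av) (nhds y). av (w - a) < t"
      using t by auto
    then show "\<forall>\<^sub>F zw in ?F. ?f zw < c"
      unfolding eventually_prod_filter
    proof (intro exI conjI allI impI)
      fix z w assume "av (z - a) < t" "av (w - a) < t"
      then have "av (z - w) < t" using av_ultra[of z w a] by (simp add: av_minus_commute[of a w])
      then show "?f (z, w) < c" using t(2) by (simp add: less_trans[of "ereal (av (z - w))" "ereal t"])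
    qed auto
  qed
  obtain z w :: "'c set \<times> real \<Rightarrow> 'c" where zw: "((\<lambda>i. type1 av (z i)) \<longlongrightarrow> x) approx_filter" "((\<lambda>i. type1 av (w i)) \<longlongrightarrow> y) approx_filter"
    "\<forall>e>0. \<forall>\<^sub>F i in approx_filter. hsia_inf x y - e < av (z i - w i)"
    using approx_net[OF x y] by blast
  have lim: "filterlim (\<lambda>i. (z i, w i)) ?F approx_filter"
    using zw(1,2) by (intro filterlim_Pair) (simp_all add: filterlim_filtercomap_iff comp_def)
  have lower: "ereal (hsia_inf x y - e) \<le> Limsup ?F ?f" if "e > 0" for e
  proof (rule Limsup_greatest)
    fix P assume "eventually P ?F"
    then have "\<forall>\<^sub>F i in approx_filter. P (z i, w i)" using lim by (simp add: filterlim_iff)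
    moreover have "\<forall>\<^sub>F i in approx_filter. hsia_inf x y - e < av (z i - w i)" using zw(3) that by blast
    ultimately have "\<forall>\<^sub>F i in approx_filter. P (z i, w i) \<and> hsia_inf x y - e < av (z i - w i)"
      by (rule eventually_conj)
    then obtain i where "P (z i, w i)" "hsia_inf x y - e < av (z i - w i)"
      using eventually_happens'[OF approx_filter_neq_bot] by blast
    then show "ereal (hsia_inf x y - e) \<le> Sup (?f ` Collect P)"
      by (intro Sup_upper2[of "?f (z i, w i)"]) auto
  qed
  obtain L where L: "Limsup ?F ?f = ereal L"
    using upper[of 0] lower[of 1] by (cases "Limsup ?F ?f") (auto simp del: ereal_max)
  have "L \<le> hsia_inf x y" using upper L by (intro hsia_inf_ge) (metis ereal_less_eq(3))
  moreover have "hsia_inf x y \<le> L"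
  proof (rule field_le_epsilon)
    fix e :: real assume "e > 0"
    from lower[OF this] show "hsia_inf x y \<le> L + e" by (simp add: L)
  qed
  ultimately show ?thesis by (simp add: hsia_kernel_def L)
qed

end

section \<open>Heights and the generalized Mandelbrot set\<close>

lemma log_plus_nonneg [simp]: "log_plus z \<ge> 0"
  by (simp add: log_plus_def)

lemma log_plus_mono: "a \<le> b \<Longrightarrow> log_plus a \<le> log_plus b"
  by (simp add: log_plus_def)

lemma log_plus_le_add: "a \<le> max b c \<Longrightarrow> log_plus a \<le> log_plus b + log_plus c"
  using log_plus_mono[of a b] log_plus_mono[of a c] log_plus_nonneg[of b] log_plus_nonneg[of c]
  by (auto simp: le_max_iff_disj simp del: log_plus_nonneg)

lemma log_plus_power:
  assumes "a \<ge> 0"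
  shows "log_plus (a ^ n) = real n * log_plus a"
proof (cases "a \<ge> 1")
  case True
  then show ?thesis by (simp add: log_plus_def one_le_power ln_realpow max_absorb1)
next
  case False
  then show ?thesis using assms by (simp add: log_plus_def power_le_one max_absorb2)
qed

lemma continuous_on_log_plus [continuous_intros]:
  "continuous_on S f \<Longrightarrow> continuous_on S (\<lambda>x. log_plus (f x))"
  unfolding log_plus_def by (intro continuous_intros) (auto simp: max_def)

fun orbit_poly :: "nat \<Rightarrow> 'c::field \<Rightarrow> nat \<Rightarrow> 'c poly" where
  "orbit_poly d g 0 = [:g:]"
| "orbit_poly d g (Suc n) = orbit_poly d g n ^ d + [:0, 1:]"

lemma poly_orbit_poly: "poly (orbit_poly d g n) c = (unicritical d c ^^ n) g"
  by (induction n) (auto simp: unicritical_def)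

lemma orbit_poly_monic:
  assumes "d \<ge> 2"
  shows "Polynomial.degree (orbit_poly d g (Suc n)) = d ^ n \<and>
         Polynomial.lead_coeff (orbit_poly d g (Suc n)) = 1"
proof (induction n)
  case 0
  have "[:g:] ^ d + [:0, 1:] = [:g ^ d, 1:]" by (simp add: poly_const_pow)
  then show ?case by simp
next
  case (Suc n)
  let ?f = "orbit_poly d g (Suc n)"
  have deg: "Polynomial.degree (?f ^ d) = d ^ Suc n"
    using Suc by (subst degree_power_eq) (auto simp del: orbit_poly.simps)
  have "Polynomial.degree [:0, 1 :: 'a:] < Polynomial.degree (?f ^ d)"
    unfolding deg using assms one_less_power[of d "Suc n"] by (simp del: power_Suc)
  then have "Polynomial.degree (?f ^ d + [:0, 1:]) = d ^ Suc n"
    "Polynomial.lead_coeff ([:0, 1:] + ?f ^ d) = Polynomial.lead_coeff (?f ^ d)"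
    using deg by (simp_all only: degree_add_eq_left lead_coeff_add_le)
  moreover have "Polynomial.lead_coeff (?f ^ d) = 1"
    unfolding lead_coeff_power conjunct2[OF Suc] by simp
  ultimately show ?case by (simp add: add.commute)
qed

definition height_seq :: "nat \<Rightarrow> 'c::field \<Rightarrow> ('c poly \<Rightarrow> real) \<Rightarrow> nat \<Rightarrow> real" where
  "height_seq d g x n = log_plus (x (orbit_poly d g n)) / real d ^ n"

context nonarch_field
begin

lemma local_height_eq: "local_height av d g c = lim (height_seq d g (type1 av c))"
  unfolding local_height_def height_seq_def type1_def poly_orbit_poly ..

text \<open>Each polynomial differs from the d-th power of its predecessor by the parameter alone,
  and \<open>log_plus\<close> turns that power into the factor \<open>d\<close>, which the
  denominators absorb.\<close>

lemma height_seq_step: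
  assumes x: "x \<in> berk_line av" and d: "d \<ge> 2"
  shows "\<bar>height_seq d g x (Suc n) - height_seq d g x n\<bar> \<le> log_plus (x [:0, 1:]) / real d ^ Suc n"
proof -
  let ?f = "orbit_poly d g n" and ?T = "[:0, 1 :: 'c:]"
  have "x (?f ^ d + ?T) \<le> max (x (?f ^ d)) (x ?T)" by (rule berk_add_le_max[OF x])
  then have 1: "log_plus (x (?f ^ d + ?T)) \<le> log_plus (x (?f ^ d)) + log_plus (x ?T)"
    by (rule log_plus_le_add)
  have "x (?f ^ d) \<le> max (x (?f ^ d + ?T)) (x ?T)"
    using berk_add_le_max[OF x, of "?f ^ d + ?T" "- ?T"] by (simp only: berk_minus[OF x] add_diff_cancel_right' flip: diff_conv_add_uminus)
  then have 2: "log_plus (x (?f ^ d)) \<le> log_plus (x (?f ^ d + ?T)) + log_plus (x ?T)"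
    by (rule log_plus_le_add)
  have 3: "log_plus (x (?f ^ d)) = real d * log_plus (x ?f)"
    by (simp add: berk_power[OF x] log_plus_power berk_nonneg[OF x])
  have "height_seq d g x (Suc n) - height_seq d g x n =
      (log_plus (x (?f ^ d + ?T)) - log_plus (x (?f ^ d))) / real d ^ Suc n"
    using d by (simp add: height_seq_def 3 field_simps)
  moreover have "\<bar>log_plus (x (?f ^ d + ?T)) - log_plus (x (?f ^ d))\<bar> \<le> log_plus (x ?T)"
    using 1 2 by linarith
  ultimately show ?thesis by (simp add: divide_right_mono)
qed

text \<open>The telescoping series is dominated by a geometric one where the parameter is bounded.
  Continuity of the limit is therefore obtained locally.\<close>

lemma height_seq_uniform_limit:
  assumes d: "d \<ge> 2" and S: "S \<subseteq> {x \<in> berk_line av. x [:0, 1:] \<le> B}"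
  shows "uniform_limit S (\<lambda>n x. height_seq d g x n) (\<lambda>x. lim (height_seq d g x)) sequentially"
proof -
  let ?h = "\<lambda>n x. height_seq d g x (Suc n) - height_seq d g x n"
  have "uniform_limit S (\<lambda>n x. \<Sum>i<n. ?h i x) (\<lambda>x. \<Sum>i. ?h i x) sequentially"
  proof (rule Weierstrass_m_test)
    fix n x assume "x \<in> S"
    then have x: "x \<in> berk_line av" "x [:0, 1:] \<le> B" using S by auto
    have "norm (?h n x) \<le> log_plus (x [:0, 1:]) / real d ^ Suc n"
      using height_seq_step[OF x(1) d] by simp
    also have "\<dots> \<le> log_plus B / real d ^ Suc n"
      using x(2) by (intro divide_right_mono log_plus_mono) auto
    finally show "norm (?h n x) \<le> log_plus B * (1 / real d) ^ Suc n"
      by (simp add: power_divide)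
  next
    show "summable (\<lambda>n. log_plus B * (1 / real d) ^ Suc n)"
      using d by (intro summable_mult) (simp add: summable_Suc_iff summable_geometric)
  qed
  then have "uniform_limit S (\<lambda>n x. (\<Sum>i<n. ?h i x) + height_seq d g x 0) (\<lambda>x. (\<Sum>i. ?h i x) + height_seq d g x 0) sequentially"
    by (intro uniform_limit_add uniform_limit_const)
  then have u: "uniform_limit S (\<lambda>n x. height_seq d g x n) (\<lambda>x. (\<Sum>i. ?h i x) + height_seq d g x 0) sequentially"
    by (simp add: sum_lessThan_telescope)
  have "(\<Sum>i. ?h i x) + height_seq d g x 0 = lim (height_seq d g x)" if "x \<in> S" for x
    using tendsto_uniform_limitI[OF u that] by (simp add: limI)
  then show ?thesis using u by (subst (asm) uniform_limit_cong') auto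
qed

lemma continuous_on_lim_height_seq:
  assumes "d \<ge> 2"
  shows "continuous_on (berk_line av) (\<lambda>x. lim (height_seq d g x))"
  unfolding continuous_on_def
proof
  fix x assume x: "x \<in> berk_line av"
  define B where "B = x [:0, 1:] + 1"
  define U where "U = ((\<lambda>y :: 'c poly \<Rightarrow> real. y [:0, 1:]) -` {..<B})"
  have U: "open U" "x \<in> U"
    unfolding U_def by (auto simp: B_def intro!: open_vimage continuous_on_product_coordinates)
  have "continuous_on (berk_line av \<inter> U) (\<lambda>x. lim (height_seq d g x))"
  proof (rule uniform_limit_theorem)
    show "\<forall>\<^sub>F n in sequentially. continuous_on (berk_line av \<inter> U) (\<lambda>x. height_seq d g x n)"
      unfolding height_seq_def using assms
      by (intro always_eventually allI continuous_intros
            continuous_on_subset[OF continuous_on_product_coordinates]) auto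
    show "uniform_limit (berk_line av \<inter> U) (\<lambda>n x. height_seq d g x n) (\<lambda>x. lim (height_seq d g x)) sequentially"
      by (rule height_seq_uniform_limit[OF assms, where B = B]) (auto simp: U_def)
  qed simp
  then have "((\<lambda>x. lim (height_seq d g x)) \<longlongrightarrow> lim (height_seq d g x)) (at x within berk_line av \<inter> U)"
    using x U by (auto simp: continuous_on_def)
  moreover have "at x within berk_line av \<inter> U = at x within berk_line av"
    by (rule at_within_nhd[OF U(2,1)]) auto
  ultimately show "((\<lambda>x. lim (height_seq d g x)) \<longlongrightarrow> lim (height_seq d g x)) (at x within berk_line av)" by simp
qed

text \<open>Every point is a limit of classical ones, so any two continuous extensions agree and the
  arbitrary choice in \<open>berk_height\<close> returns this limit.\<close>

lemma berk_height_eq: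
  assumes "d \<ge> 2" and x: "x \<in> berk_line av"
  shows "berk_height av d g x = lim (height_seq d g x)"
proof -
  let ?ok = "\<lambda>H. continuous_on (berk_line av) H \<and> (\<forall>c. H (type1 av c) = local_height av d g c)"
  have ok: "?ok (\<lambda>x. lim (height_seq d g x))"
    using continuous_on_lim_height_seq[OF assms(1)] local_height_eq by simp
  then have "?ok (berk_height av d g)"
    unfolding berk_height_def by (rule someI[where P = ?ok])
  moreover obtain z :: "'c set \<times> real \<Rightarrow> 'c" where z: "((\<lambda>i. type1 av (z i)) \<longlongrightarrow> x) approx_filter"
    using approx_net[OF x x] by blast
  have lim: "((\<lambda>i. H (type1 av (z i))) \<longlongrightarrow> H x) approx_filter" if "?ok H" for H
    using continuous_on_tendsto_compose[OF conjunct1[OF that] z x] by simp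
  ultimately show ?thesis
    using lim[OF ok] lim[of "berk_height av d g"] ok
      tendsto_unique[OF approx_filter_neq_bot] by auto
qed

lemma height_seq_tendsto:
  assumes "d \<ge> 2" and x: "x \<in> berk_line av"
  shows "height_seq d g x \<longlonglongrightarrow> berk_height av d g x"
  unfolding berk_height_eq[OF assms]
  by (rule tendsto_uniform_limitI[OF height_seq_uniform_limit[OF assms(1), where S = "{x}" and B = "x [:0, 1:]"]])
     (use x in auto)

text \<open>For such a parameter the summand \<open>g ^ d\<close> is negligible, so the first
  iterate has the size of the parameter, which exceeds 1; from then on the d-th power dominates the
  added parameter.\<close>

lemma orbit_poly_ge:
  assumes x: "x \<in> berk_line av" and d: "d \<ge> 2" and T: "x [:0, 1:] > max 1 (av g) ^ d"
  shows "x (orbit_poly d g (Suc n)) \<ge> x [:0, 1:]"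
proof (induction n)
  case 0
  have "x ([:g:] ^ d) = av g ^ d" by (simp add: berk_power[OF x] berk_const[OF x])
  also have "\<dots> \<le> max 1 (av g) ^ d" by (intro power_mono) auto
  finally have "x ([:g:] ^ d) < x [:0, 1:]" using T by simp
  then show ?case using berk_add_eq_max[OF x, of "[:g:] ^ d" "[:0, 1:]"] by simp
next
  case (Suc n)
  let ?f = "orbit_poly d g (Suc n)"
  have "1 \<le> max 1 (av g) ^ d" by (simp add: one_le_power)
  then have "1 < x [:0, 1:]" using T by linarith
  moreover from this have "x ?f ^ 1 < x ?f ^ d"
    using Suc d by (intro power_strict_increasing) auto
  ultimately have "x [:0, 1:] < x (?f ^ d)" using Suc by (simp add: berk_power[OF x])
  then show ?case using berk_add_eq_max[OF x, of "?f ^ d" "[:0, 1:]"] by simp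
qed

text \<open>It suffices that the parameter is smaller than the d-th power of the iterate. Either it
  is at most \<open>max 1 (av g) ^ d\<close>, which that power exceeds, or the iterate is at least
  as large as the parameter.\<close>

lemma orbit_poly_escape:
  assumes x: "x \<in> berk_line av" and d: "d \<ge> 2" and f: "x (orbit_poly d g (Suc n)) > max 1 (av g)"
  shows "x (orbit_poly d g (Suc (Suc n))) = x (orbit_poly d g (Suc n)) ^ d"
proof -
  let ?f = "orbit_poly d g (Suc n)"
  have "x [:0, 1:] < x ?f ^ d"
  proof (cases "x [:0, 1:] > max 1 (av g) ^ d")
    case True
    have "x ?f ^ 1 < x ?f ^ d" using f d by (intro power_strict_increasing) auto
    then show ?thesis using orbit_poly_ge[OF x d True, of n] by simp
  next
    case False
    moreover have "max 1 (av g) ^ d < x ?f ^ d" using f d by (intro power_strict_mono) auto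
    ultimately show ?thesis by simp
  qed
  then show ?thesis
    using berk_add_eq_max[OF x, of "?f ^ d" "[:0, 1:]"] by (simp add: berk_power[OF x])
qed

text \<open>Bounded iterates make the heights tend to 0. After the first excess over the bound each
  step raises the absolute value exactly to the power \<open>d\<close>, so the height sequence is
  constant and positive from there on.\<close>

lemma mandelbrot_eq:
  assumes d: "d \<ge> 2"
  shows "mandelbrot av d g = {x \<in> berk_line av. \<forall>n. x (orbit_poly d g (Suc n)) \<le> max 1 (av g)}"
proof -
  let ?R = "max 1 (av g)"
  have "berk_height av d g x = 0 \<longleftrightarrow> (\<forall>n. x (orbit_poly d g (Suc n)) \<le> ?R)" if x: "x \<in> berk_line av" for x
  proof
    assume bd: "\<forall>n. x (orbit_poly d g (Suc n)) \<le> ?R"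
    have "(\<lambda>n. height_seq d g x (Suc n)) \<longlonglongrightarrow> 0"
    proof (rule tendsto_sandwich[where f = "\<lambda>_. 0"])
      show "\<forall>\<^sub>F n in sequentially. height_seq d g x (Suc n) \<le> log_plus ?R * (1 / real d) ^ Suc n"
        using bd unfolding height_seq_def by (intro always_eventually allI)
          (simp only: power_divide power_one times_divide_eq_right mult_1_right, intro divide_right_mono log_plus_mono, auto)
      have "(\<lambda>n. (1 / real d) ^ Suc n) \<longlonglongrightarrow> 0"
        using d by (intro LIMSEQ_Suc LIMSEQ_power_zero) simp
      then show "(\<lambda>n. log_plus ?R * (1 / real d) ^ Suc n) \<longlonglongrightarrow> 0"
        by (rule tendsto_mult_right_zero)
      show "\<forall>\<^sub>F n in sequentially. 0 \<le> height_seq d g x (Suc n)"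
        by (simp add: height_seq_def del: orbit_poly.simps)
    qed simp
    then show "berk_height av d g x = 0"
      using LIMSEQ_unique[OF LIMSEQ_Suc[OF height_seq_tendsto[OF d x, of g]]] by blast
  next
    assume h0: "berk_height av d g x = 0"
    show "\<forall>n. x (orbit_poly d g (Suc n)) \<le> ?R"
    proof (rule ccontr)
      assume "\<not> ?thesis"
      then obtain n where n: "x (orbit_poly d g (Suc n)) > ?R" by (auto simp: not_le)
      let ?s = "x (orbit_poly d g (Suc n))"
      have it: "x (orbit_poly d g (Suc (n + k))) = ?s ^ (d ^ k) \<and> x (orbit_poly d g (Suc (n + k))) > ?R" for k
      proof (induction k)
        case (Suc k)
        have "x (orbit_poly d g (Suc (n + Suc k))) = x (orbit_poly d g (Suc (n + k))) ^ d"
          using orbit_poly_escape[OF x d, of g "n + k"] Suc by simp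
        then have eq: "x (orbit_poly d g (Suc (n + Suc k))) = ?s ^ (d ^ Suc k)"
          using Suc by (simp add: power_mult[symmetric] mult.commute)
        have "?s ^ 1 \<le> ?s ^ (d ^ Suc k)"
          using n d by (intro power_increasing) auto
        then show ?case using eq n by simp
      qed (use n in simp)
      have hs: "height_seq d g x (k + Suc n) = ln ?s / real d ^ Suc n" for k
      proof -
        have "log_plus (x (orbit_poly d g (k + Suc n))) = real (d ^ k) * log_plus ?s"
          using it[of k] log_plus_power[OF berk_nonneg[OF x]] by (simp add: add.commute)
        moreover have "log_plus ?s = ln ?s" using n by (simp add: log_plus_def)
        ultimately show ?thesis using d by (simp add: height_seq_def power_add)
      qed
      have "(\<lambda>k. height_seq d g x (k + Suc n)) \<longlonglongrightarrow> 0"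
        using LIMSEQ_ignore_initial_segment[OF height_seq_tendsto[OF d x, of g], of "Suc n"] h0 by simp
      then have "ln ?s / real d ^ Suc n = 0" unfolding hs by (simp add: LIMSEQ_const_iff)
      then show False using n d by simp
    qed
  qed
  then show ?thesis by (auto simp: mandelbrot_def)
qed

end

section \<open>Ultrametric energies and lemniscates\<close>

text \<open>The matrix of a partial equivalence relation consists of diagonal blocks of ones.
  Summing over all \<open>k\<close> and dividing by the block size \<open>c k\<close> turns the form
  into a sum of squares. Where \<open>c k = 0\<close>, the numerators vanish as well.\<close>

lemma per_form_nonneg:
  fixes s :: "'i \<Rightarrow> real"
  assumes "finite I" and sym: "\<And>i j. r i j \<Longrightarrow> r j i"
    and trans: "\<And>i j k. i \<in> I \<Longrightarrow> j \<in> I \<Longrightarrow> k \<in> I \<Longrightarrow> r i j \<Longrightarrow> r j k \<Longrightarrow> r i k"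
  shows "(\<Sum>i\<in>I. \<Sum>j\<in>I. s i * s j * of_bool (r i j)) \<ge> 0"
proof -
  define c where "c k = real (card {l \<in> I. r k l})" for k
  have r: "of_bool (r i j) = (\<Sum>k\<in>I. of_bool (r i k) * of_bool (r k j) / c k)" if ij: "i \<in> I" "j \<in> I" for i j
  proof (cases "r i j")
    case True
    have "(\<Sum>k\<in>I. of_bool (r i k) * of_bool (r k j) / c k) = (\<Sum>k\<in>I. of_bool (r i k) / c i)"
    proof (rule sum.cong)
      fix k assume k: "k \<in> I"
      show "of_bool (r i k) * of_bool (r k j) / c k = (of_bool (r i k) / c i :: real)"
      proof (cases "r i k")
        case rik: True
        then have "r k j" using trans[OF k ij sym[OF rik] True] by simp
        moreover have "{l \<in> I. r k l} = {l \<in> I. r i l}"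
      proof (intro Collect_cong conj_cong refl)
        fix l assume "l \<in> I"
        then show "r k l \<longleftrightarrow> r i l"
          using trans[OF ij(1) k _ rik] trans[OF k ij(1) _ sym[OF rik]] by blast
      qed
        then have "c k = c i" by (simp add: c_def)
        ultimately show ?thesis by simp
      qed simp
    qed simp
    also have "\<dots> = real (card {k \<in> I. r i k}) / c i"
      using assms(1) by (simp add: sum_divide_distrib[symmetric] of_bool_def sum.If_cases Int_def)
    also have "\<dots> = 1"
    proof -
      have "r i i" using trans[OF ij(1,2,1) True sym[OF True]] .
      then have "{k \<in> I. r i k} \<noteq> {}" using ij by blast
      then have "card {k \<in> I. r i k} \<noteq> 0" using assms(1) by simp
      then show ?thesis by (simp add: c_def)
    qed
    finally show ?thesis using True by simp
  next
    case False
    then have "\<not> (r i k \<and> r k j)" if "k \<in> I" for k using trans[of i k j] that ij by blast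
    then have "(\<Sum>k\<in>I. of_bool (r i k) * of_bool (r k j) / c k) = 0"
      by (intro sum.neutral) (auto simp: of_bool_def)
    with False show ?thesis by simp
  qed
  have "(\<Sum>i\<in>I. \<Sum>j\<in>I. s i * s j * of_bool (r i j)) =
      (\<Sum>i\<in>I. \<Sum>j\<in>I. \<Sum>k\<in>I. (s i * of_bool (r i k)) * (s j * of_bool (r k j)) / c k)"
  proof (intro sum.cong refl)
    fix i j assume "i \<in> I" "j \<in> I"
    from r[OF this] show "s i * s j * of_bool (r i j) =
        (\<Sum>k\<in>I. (s i * of_bool (r i k)) * (s j * of_bool (r k j)) / c k)"
      by (simp only: sum_distrib_left) (simp add: mult_ac)
  qed
  also have "\<dots> = (\<Sum>i\<in>I. \<Sum>k\<in>I. \<Sum>j\<in>I. (s i * of_bool (r i k)) * (s j * of_bool (r k j)) / c k)"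
    by (rule sum.cong[OF refl]) (rule sum.swap)
  also have "\<dots> = (\<Sum>k\<in>I. \<Sum>i\<in>I. \<Sum>j\<in>I. (s i * of_bool (r i k)) * (s j * of_bool (r k j)) / c k)"
    by (rule sum.swap)
  also have "\<dots> = (\<Sum>k\<in>I. (\<Sum>i\<in>I. s i * of_bool (r i k)) * (\<Sum>j\<in>I. s j * of_bool (r k j)) / c k)"
    by (simp add: sum_product sum_divide_distrib)
  also have "\<dots> = (\<Sum>k\<in>I. (\<Sum>i\<in>I. s i * of_bool (r i k))\<^sup>2 / c k)"
  proof -
    have "(\<Sum>j\<in>I. s j * of_bool (r k j)) = (\<Sum>j\<in>I. s j * of_bool (r j k))" for k
      by (rule sum.cong) (use sym[of k] sym[of _ k] in \<open>auto simp: of_bool_def\<close>)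
    then show ?thesis by (simp only: power2_eq_square)
  qed
  also have "\<dots> \<ge> 0" by (intro sum_nonneg) (simp add: c_def)
  finally show ?thesis .
qed

text \<open>For an ultrametric kernel each set \<open>{(i, j). \<delta> i j \<le> e ^ t}\<close> is a partial equivalence relation, and
  \<open>- ln \<delta>\<close> is up to a constant the integral of the indicators of these sets over \<open>t\<close>.\<close>

lemma ultrametric_log_form_nonneg:
  fixes \<delta> :: "'i \<Rightarrow> 'i \<Rightarrow> real"
  assumes fin: "finite I" and pos: "\<And>i j. i \<in> I \<Longrightarrow> j \<in> I \<Longrightarrow> \<delta> i j > 0"
    and sym: "\<And>i j. i \<in> I \<Longrightarrow> j \<in> I \<Longrightarrow> \<delta> i j = \<delta> j i"
    and ultra: "\<And>i j k. i \<in> I \<Longrightarrow> j \<in> I \<Longrightarrow> k \<in> I \<Longrightarrow> \<delta> i k \<le> max (\<delta> i j) (\<delta> j k)"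
    and sum0: "(\<Sum>i\<in>I. s i) = 0"
  shows "(\<Sum>i\<in>I. \<Sum>j\<in>I. s i * s j * (- ln (\<delta> i j))) \<ge> 0"
proof -
  \<comment> \<open>Any common upper bound of the logarithms serves:
    \<open>B - ln (\<delta> i j)\<close> is the length of the interval from
    \<open>ln (\<delta> i j)\<close> to \<open>B\<close>, and \<open>B\<close> drops out because the
    weights sum to 0.\<close>
  define B where "B = (\<Sum>i\<in>I. \<Sum>j\<in>I. \<bar>ln (\<delta> i j)\<bar>)"
  have B: "ln (\<delta> i j) \<le> B" if "i \<in> I" "j \<in> I" for i j
  proof -
    have "\<bar>ln (\<delta> i j)\<bar> \<le> (\<Sum>j\<in>I. \<bar>ln (\<delta> i j)\<bar>)"
      using that fin by (intro member_le_sum) auto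
    also have "\<dots> \<le> B"
      unfolding B_def using that fin by (intro member_le_sum) (auto intro: sum_nonneg)
    finally show ?thesis by simp
  qed
  let ?ind = "\<lambda>i j t. indicator {ln (\<delta> i j)..B} t :: real"
  have int: "integrable lborel (\<lambda>t. c * ?ind i j t)" for c i j
    by (intro integrable_mult_right integrable_real_indicator) (auto simp: emeasure_lborel_Icc_eq)
  have "(\<Sum>i\<in>I. \<Sum>j\<in>I. s i * s j * (- ln (\<delta> i j))) =
      (\<Sum>i\<in>I. \<Sum>j\<in>I. s i * s j * (B - ln (\<delta> i j))) - B * (\<Sum>i\<in>I. s i) * (\<Sum>j\<in>I. s j)"
  proof -
    have "B * (\<Sum>i\<in>I. s i) * (\<Sum>j\<in>I. s j) = (\<Sum>i\<in>I. \<Sum>j\<in>I. B * s i * s j)"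
      unfolding mult.assoc sum_product by (simp only: sum_distrib_left)
    moreover have "s i * s j * (- ln (\<delta> i j)) = s i * s j * (B - ln (\<delta> i j)) - B * s i * s j" for i j
      by (simp add: algebra_simps)
    ultimately show ?thesis by (simp only: sum_subtractf)
  qed
  also have "\<dots> = (\<Sum>i\<in>I. \<Sum>j\<in>I. s i * s j * (B - ln (\<delta> i j)))" by (simp add: sum0)
  also have "\<dots> = (\<Sum>i\<in>I. \<Sum>j\<in>I. \<integral>t. s i * s j * ?ind i j t \<partial>lborel)"
  proof (intro sum.cong refl)
    fix i j assume "i \<in> I" "j \<in> I"
    then have "(\<integral>t. ?ind i j t \<partial>lborel) = B - ln (\<delta> i j)"
      using B by (simp only: Bochner_Integration.integral_indicator) simp
    then show "s i * s j * (B - ln (\<delta> i j)) = (\<integral>t. s i * s j * ?ind i j t \<partial>lborel)"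
      by (simp only: Bochner_Integration.integral_mult_right_zero)
  qed
  also have "\<dots> = (\<integral>t. (\<Sum>i\<in>I. \<Sum>j\<in>I. s i * s j * ?ind i j t) \<partial>lborel)"
  proof -
    have "(\<integral>t. (\<Sum>i\<in>I. \<Sum>j\<in>I. s i * s j * ?ind i j t) \<partial>lborel) = (\<Sum>i\<in>I. \<integral>t. (\<Sum>j\<in>I. s i * s j * ?ind i j t) \<partial>lborel)"
      by (intro Bochner_Integration.integral_sum Bochner_Integration.integrable_sum int)
    also have "\<dots> = (\<Sum>i\<in>I. \<Sum>j\<in>I. \<integral>t. s i * s j * ?ind i j t \<partial>lborel)"
      by (intro sum.cong refl Bochner_Integration.integral_sum int)
    finally show ?thesis by simp
  qed
  also have "\<dots> \<ge> 0"
  proof (rule Bochner_Integration.integral_nonneg)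
    fix t
    define r where "r i j \<longleftrightarrow> i \<in> I \<and> j \<in> I \<and> ln (\<delta> i j) \<le> t" for i j
    show "0 \<le> (\<Sum>i\<in>I. \<Sum>j\<in>I. s i * s j * ?ind i j t)"
    proof (cases "t \<le> B")
      case True
      have "0 \<le> (\<Sum>i\<in>I. \<Sum>j\<in>I. s i * s j * of_bool (r i j))"
      proof (rule per_form_nonneg[OF fin])
        fix i j k assume ijk: "i \<in> I" "j \<in> I" "k \<in> I" "r i j" "r j k"
        have "ln (\<delta> i k) \<le> ln (max (\<delta> i j) (\<delta> j k))"
          using ijk ultra[of i j k] pos by (intro ln_mono) auto
        then show "r i k" using ijk by (auto simp: r_def max_def split: if_splits)
      qed (use sym in \<open>auto simp: r_def\<close>)
      also have "\<dots> = (\<Sum>i\<in>I. \<Sum>j\<in>I. s i * s j * ?ind i j t)"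
        using True by (intro sum.cong refl) (simp add: r_def indicator_def)
      finally show ?thesis .
    qed (simp add: indicator_def)
  qed
  finally show ?thesis .
qed

text \<open>The points \<open>\<rho> i\<close> are the zeros, with multiplicity, of a monic polynomial of degree \<open>N\<close>. The
  set where this polynomial is at most \<open>R\<close> in absolute value is the union of the closed discs around the
  \<open>\<rho> i\<close> with radii \<open>rad i\<close>.\<close>

locale lemniscate = nonarch_field av for av :: "'c::alg_closed_field \<Rightarrow> real" +
  fixes \<rho> :: "nat \<Rightarrow> 'c" and N :: nat and R :: real
  assumes R: "R \<ge> 1" and N: "N > 0"
begin

text \<open>The factor \<open>j = i\<close> is the radius itself and the others do not decrease. The
  product is the absolute value of the polynomial at the point of a disc around
  \<open>\<rho> i\<close>.\<close>

lemma prod_max_strict_mono: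
  assumes "i < N" "0 \<le> s" "s < t"
  shows "(\<Prod>j<N. max s (av (\<rho> i - \<rho> j))) < (\<Prod>j<N. max t (av (\<rho> i - \<rho> j)))"
proof -
  have split: "(\<Prod>j<N. max u (av (\<rho> i - \<rho> j))) = u * (\<Prod>j\<in>{..<N} - {i}. max u (av (\<rho> i - \<rho> j)))"
    if "u \<ge> 0" for u
    using assms(1) that by (subst prod.remove[of _ i]) auto
  have le: "(\<Prod>j\<in>{..<N} - {i}. max s (av (\<rho> i - \<rho> j))) \<le> (\<Prod>j\<in>{..<N} - {i}. max t (av (\<rho> i - \<rho> j)))"
    using assms by (intro prod_mono) auto
  have pos: "0 < (\<Prod>j\<in>{..<N} - {i}. max t (av (\<rho> i - \<rho> j)))"
    using assms by (intro prod_pos) auto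
  have "s * (\<Prod>j\<in>{..<N} - {i}. max s (av (\<rho> i - \<rho> j))) \<le> s * (\<Prod>j\<in>{..<N} - {i}. max t (av (\<rho> i - \<rho> j)))"
    using le assms by (intro mult_left_mono) auto
  also have "\<dots> < t * (\<Prod>j\<in>{..<N} - {i}. max t (av (\<rho> i - \<rho> j)))"
    using pos assms by (intro mult_strict_right_mono) auto
  finally show ?thesis using assms by (simp add: split)
qed

definition rad :: "nat \<Rightarrow> real" where
  "rad i = (SOME r. 0 \<le> r \<and> r \<le> R \<and> (\<Prod>j<N. max r (av (\<rho> i - \<rho> j))) = R)"

text \<open>Intermediate value theorem: the factor \<open>j = i\<close> makes the product vanish at
  radius 0, while at radius \<open>R\<close> every factor is at least \<open>R\<close> and
  \<open>R ^ N \<ge> R\<close>.\<close>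

lemma rad:
  assumes i: "i < N"
  shows rad_nonneg: "0 \<le> rad i" and rad_le: "rad i \<le> R"
    and rad_prod: "(\<Prod>j<N. max (rad i) (av (\<rho> i - \<rho> j))) = R"
proof -
  let ?f = "\<lambda>r. \<Prod>j<N. max r (av (\<rho> i - \<rho> j))"
  have "?f 0 = 0" using i by (intro prod_zero) auto
  then have "?f 0 \<le> R" using R by linarith
  moreover have "R \<le> ?f R"
  proof -
    have "R ^ 1 \<le> R ^ N" using R N by (intro power_increasing) auto
    also have "R ^ N = (\<Prod>j<N. R)" by simp
    also have "\<dots> \<le> ?f R" using R by (intro prod_mono) auto
    finally show ?thesis by simp
  qed
  moreover have "continuous_on {0..R} ?f" by (intro continuous_intros)
  ultimately have "\<exists>r\<ge>0. r \<le> R \<and> ?f r = R" using R by (intro IVT'[of ?f]) auto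
  from someI_ex[OF this] have "0 \<le> rad i \<and> rad i \<le> R \<and> ?f (rad i) = R"
    unfolding rad_def .
  then show "0 \<le> rad i" "rad i \<le> R" "?f (rad i) = R" by auto
qed

lemma rad_pos:
  assumes "i < N"
  shows "0 < rad i"
proof (rule ccontr)
  assume "\<not> 0 < rad i"
  then have "rad i = 0" using rad_nonneg[OF assms] by simp
  then have "(\<Prod>j<N. max (rad i) (av (\<rho> i - \<rho> j))) = 0"
    using assms by (intro prod_zero) auto
  then show False using rad_prod[OF assms] R by simp
qed

lemma rad_unique:
  assumes "i < N" "r \<ge> 0" "(\<Prod>j<N. max r (av (\<rho> i - \<rho> j))) = R"
  shows "rad i = r"
proof (rule ccontr)
  assume "rad i \<noteq> r"
  then consider "rad i < r" | "r < rad i" by linarith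
  then show False
    using prod_max_strict_mono[OF assms(1) rad_nonneg[OF assms(1)], of r]
      prod_max_strict_mono[OF assms(1,2), of "rad i"] rad_prod[OF assms(1)] assms(3)
    by cases auto
qed

lemma max_av_cong:
  assumes "av (a - b) \<le> r"
  shows "max r (av (a - c)) = max r (av (b - c))"
proof -
  have "av (b - a) \<le> r" using assms by (simp add: av_minus_commute)
  then show ?thesis using assms av_ultra[of a c b] av_ultra[of b c a] by linarith
qed

lemma rad_cong:
  assumes i: "i < N" and k: "k < N" and ik: "av (\<rho> i - \<rho> k) \<le> rad i"
  shows "rad k = rad i"
proof (rule rad_unique[OF k rad_nonneg[OF i]])
  have "max (rad i) (av (\<rho> k - \<rho> j)) = max (rad i) (av (\<rho> i - \<rho> j))" for j
    using max_av_cong[OF ik] by simp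
  then show "(\<Prod>j<N. max (rad i) (av (\<rho> k - \<rho> j))) = R" using rad_prod[OF i] by simp
qed

text \<open>The radius of the smallest disc containing the discs of \<open>i\<close> and
  \<open>j\<close>, positive also for \<open>i = j\<close>. Only \<open>rad i\<close> occurs because
  discs that meet have equal radii.\<close>

definition disc_dist :: "nat \<Rightarrow> nat \<Rightarrow> real" where
  "disc_dist i j = max (rad i) (av (\<rho> i - \<rho> j))"

lemma disc_dist_pos: "i < N \<Longrightarrow> disc_dist i j > 0"
  using rad_pos by (auto simp: disc_dist_def less_max_iff_disj)

lemma disc_dist_sym:
  assumes "i < N" "j < N"
  shows "disc_dist i j = disc_dist j i"
proof (cases "av (\<rho> i - \<rho> j) \<le> rad i \<or> av (\<rho> i - \<rho> j) \<le> rad j")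
  case True
  then have "rad i = rad j"
    using rad_cong[OF assms] rad_cong[OF assms(2,1)] by (auto simp: av_minus_commute)
  then show ?thesis by (simp add: disc_dist_def av_minus_commute)
next
  case False
  then show ?thesis by (auto simp: disc_dist_def av_minus_commute[of "\<rho> j"])
qed

lemma rad_le_disc_dist: "i < N \<Longrightarrow> j < N \<Longrightarrow> rad i \<le> disc_dist i j" "i < N \<Longrightarrow> j < N \<Longrightarrow> rad j \<le> disc_dist i j"
  using disc_dist_sym[of i j] by (auto simp: disc_dist_def)

lemma disc_dist_ultra:
  assumes "i < N" "j < N" "k < N"
  shows "disc_dist i k \<le> max (disc_dist i j) (disc_dist j k)"
  using av_ultra[of "\<rho> i" "\<rho> k" "\<rho> j"] by (auto simp: disc_dist_def)

lemma disc_dist_prod: "i < N \<Longrightarrow> (\<Prod>j<N. disc_dist i j) = R"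
  unfolding disc_dist_def by (rule rad_prod)

lemma disc_dist_potential:
  assumes "i < N"
  shows "(\<Sum>j<N. - ln (disc_dist i j)) = - ln R"
proof -
  have "ln (\<Prod>j<N. disc_dist i j) = (\<Sum>j<N. ln (disc_dist i j))"
    using disc_dist_pos[OF assms] by (intro ln_prod) (auto simp: less_le)
  then show ?thesis using disc_dist_prod[OF assms] by (simp add: sum_negf)
qed

lemma disc_dist_cong:
  assumes "i < N" "k < N" "av (\<rho> i - \<rho> k) \<le> rad i"
  shows "disc_dist i j = disc_dist k j"
  using max_av_cong[OF assms(3)] rad_cong[OF assms] by (simp add: disc_dist_def)

text \<open>For the zero \<open>\<rho> i\<close> nearest to \<open>x\<close>, every factor
  \<open>x (lin (\<rho> j))\<close> is at least the maximum of \<open>x (lin (\<rho> i))\<close> and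
  \<open>av (\<rho> i - \<rho> j)\<close>. If \<open>x\<close> lay outside the disc of
  \<open>i\<close>, strict monotonicity would push the product above \<open>R\<close>.\<close>

lemma cover:
  assumes x: "x \<in> berk_line av" and "(\<Prod>j<N. x (lin (\<rho> j))) \<le> R"
  shows "\<exists>i<N. x (lin (\<rho> i)) \<le> rad i"
proof -
  define i where "i = arg_min_on (\<lambda>j. x (lin (\<rho> j))) {..<N}"
  have "{..<N} \<noteq> {}" using N by (simp add: lessThan_empty_iff)
  then have i: "i < N" "\<And>j. j < N \<Longrightarrow> x (lin (\<rho> i)) \<le> x (lin (\<rho> j))"
    unfolding i_def using arg_min_if_finite(1)[of "{..<N}" "\<lambda>j. x (lin (\<rho> j))"]
      arg_min_least[of "{..<N}" _ "\<lambda>j. x (lin (\<rho> j))"] by auto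
  have "x (lin (\<rho> i)) \<le> rad i"
  proof (rule ccontr)
    assume "\<not> ?thesis"
    then have "R < (\<Prod>j<N. max (x (lin (\<rho> i))) (av (\<rho> i - \<rho> j)))"
      using prod_max_strict_mono[OF i(1) rad_nonneg[OF i(1)]] rad_prod[OF i(1)] by simp
    also have "\<dots> \<le> (\<Prod>j<N. x (lin (\<rho> j)))"
    proof (rule prod_mono)
      fix j assume "j \<in> {..<N}"
      then have "x (lin (\<rho> i)) \<le> x (lin (\<rho> j))" using i(2) by simp
      then show "0 \<le> max (x (lin (\<rho> i))) (av (\<rho> i - \<rho> j)) \<and>
          max (x (lin (\<rho> i))) (av (\<rho> i - \<rho> j)) \<le> x (lin (\<rho> j))"
        using berk_lin_diff_le[OF x, of "\<rho> i" "\<rho> j"] berk_nonneg[OF x] by (auto simp: le_max_iff_disj)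
    qed
    finally show False using assms(2) by simp
  qed
  with i(1) show ?thesis by blast
qed

lemma max_le_disc_dist:
  assumes x: "x \<in> berk_line av" and y: "y \<in> berk_line av" and "i < N" "j < N"
    and "x (lin (\<rho> i)) \<le> rad i" "y (lin (\<rho> j)) \<le> rad j"
  shows "max (x (lin (\<rho> i))) (y (lin (\<rho> i))) \<le> disc_dist i j"
proof -
  have "y (lin (\<rho> i)) \<le> max (rad j) (av (\<rho> i - \<rho> j))"
    using berk_lin_le[OF y, of "\<rho> i" "\<rho> j"] assms by linarith
  moreover have "\<dots> \<le> disc_dist i j"
    using rad_le_disc_dist[OF assms(3,4)] by (simp add: disc_dist_def)
  ultimately show ?thesis using assms rad_le_disc_dist[OF assms(3,4)] by simp
qed

text \<open>The difference of \<open>m\<close> and the uniform weights has total 0. When its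
  nonnegative form is expanded, constancy of the potential makes both cross terms and the uniform
  term equal to \<open>- ln R / N\<close> up to sign, and one copy remains.\<close>

lemma energy_lower_bound:
  assumes m: "(\<Sum>i<N. m i) = 1"
  shows "(\<Sum>i<N. \<Sum>j<N. m i * m j * (- ln (disc_dist i j))) \<ge> - ln R / N"
proof -
  let ?k = "\<lambda>i j. - ln (disc_dist i j)" and ?c = "1 / real N"
  have s: "(\<Sum>i<N. m i - ?c) = 0" using m N by (simp add: sum_subtractf)
  have "0 \<le> (\<Sum>i<N. \<Sum>j<N. (m i - ?c) * (m j - ?c) * ?k i j)"
    by (rule ultrametric_log_form_nonneg) (use disc_dist_pos disc_dist_sym disc_dist_ultra s in auto)
  also have "\<dots> = (\<Sum>i<N. \<Sum>j<N. m i * m j * ?k i j) - (\<Sum>i<N. m i * ?c * (\<Sum>j<N. ?k i j))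
      - (\<Sum>i<N. \<Sum>j<N. ?c * m j * ?k i j) + (\<Sum>i<N. ?c * ?c * (\<Sum>j<N. ?k i j))"
    unfolding sum_distrib_left sum.distrib[symmetric] sum_subtractf[symmetric]
    by (intro sum.cong refl) (simp add: algebra_simps)
  also have "(\<Sum>i<N. \<Sum>j<N. ?c * m j * ?k i j) = (\<Sum>j<N. m j * ?c * (\<Sum>i<N. ?k j i))"
    by (subst sum.swap) (auto simp: sum_distrib_left disc_dist_sym intro!: sum.cong)
  also have "(\<Sum>i<N. m i * ?c * (\<Sum>j<N. ?k i j)) = (\<Sum>i<N. m i * (?c * - ln R))"
    by (intro sum.cong refl) (simp add: disc_dist_potential)
  also have "\<dots> = - ln R / N" by (simp only: m mult_1_left flip: sum_distrib_right) simp
  also have "(\<Sum>i<N. ?c * ?c * (\<Sum>j<N. ?k i j)) = (\<Sum>i<N. ?c * ?c * - ln R)"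
    by (intro sum.cong refl) (simp add: disc_dist_potential)
  also have "\<dots> = - ln R / N" using N by simp
  finally show ?thesis by simp
qed

end

section \<open>Zeros of consecutive polynomials\<close>

lemma (in comm_monoid_set) nat_div_group:
  "F (\<lambda>k. g (k div b)) {..<a * b} = F (\<lambda>j. F (\<lambda>_. g j) {..<b}) {..<a :: nat}"
proof -
  have "F (\<lambda>k. g (k div b)) {..<a * b} = F (\<lambda>j. F (\<lambda>k. g (k div b)) {j * b..<j * b + b}) {..<a}"
    by (rule nat_group[symmetric])
  also have "\<dots> = F (\<lambda>j. F (\<lambda>_. g j) {..<b}) {..<a}"
  proof (rule cong)
    fix j
    have "F (\<lambda>k. g (k div b)) {j * b..<j * b + b} = F (\<lambda>k. g ((j * b + k) div b)) {0..<b}"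
      using shift_bounds_nat_ivl[of "\<lambda>k. g (k div b)" 0 "j * b" b] by (simp add: add.commute)
    also have "\<dots> = F (\<lambda>_. g j) {..<b}"
      by (intro cong) (auto simp: atLeast0LessThan)
    finally show "F (\<lambda>k. g (k div b)) {j * b..<j * b + b} = F (\<lambda>_. g j) {..<b}" .
  qed simp
  finally show ?thesis .
qed

text \<open>The exponent of growth of \<open>s \<mapsto> (\<Prod>k\<in>K. max s (b k))\<close> just above \<open>r\<close> counts the \<open>b k\<close> that are at
  most \<open>r\<close>.\<close>

lemma card_le_eq_of_prod_max_eq:
  fixes b c :: "'k \<Rightarrow> real"
  assumes "finite K" "r \<ge> 0"
    and eq: "\<And>s. s > r \<Longrightarrow> (\<Prod>k\<in>K. max s (b k)) = (\<Prod>k\<in>K. max s (c k))"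
  shows "card {k \<in> K. b k \<le> r} = card {k \<in> K. c k \<le> r}"
proof -
  \<comment> \<open>No value of \<open>b\<close> or \<open>c\<close> lies strictly between
    \<open>r\<close> and \<open>t\<close>, so there both products are a constant times a power of
    \<open>s\<close>. Comparing them at two radii eliminates the constants.\<close>
  define t where "t = Min (insert (r + 1) ({u \<in> b ` K \<union> c ` K. u > r}))"
  have fin: "finite {u \<in> b ` K \<union> c ` K. u > r}" using assms(1) by simp
  have t: "t > r" using fin by (simp add: t_def)
  have t_le: "t \<le> u" if "u \<in> b ` K \<union> c ` K" "u > r" for u
    unfolding t_def using fin that by (intro Min_le) auto
  have split: "(\<Prod>k\<in>K. max s (f k)) = s ^ card {k \<in> K. f k \<le> r} * (\<Prod>k\<in>{k \<in> K. f k > r}. f k)"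
    if s: "r < s" "s \<le> t" and f: "f ` K \<subseteq> b ` K \<union> c ` K" for s f
  proof -
    have "(\<Prod>k\<in>K. max s (f k)) = (\<Prod>k\<in>{k \<in> K. f k \<le> r} \<union> {k \<in> K. f k > r}. max s (f k))"
      by (intro prod.cong) auto
    also have "\<dots> = (\<Prod>k\<in>{k \<in> K. f k \<le> r}. max s (f k)) * (\<Prod>k\<in>{k \<in> K. f k > r}. max s (f k))"
      using assms(1) by (intro prod.union_disjoint) auto
    also have "(\<Prod>k\<in>{k \<in> K. f k \<le> r}. max s (f k)) = (\<Prod>k\<in>{k \<in> K. f k \<le> r}. s)"
      using s by (intro prod.cong) auto
    also have "(\<Prod>k\<in>{k \<in> K. f k > r}. max s (f k)) = (\<Prod>k\<in>{k \<in> K. f k > r}. f k)"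
    proof (rule prod.cong)
      fix k assume "k \<in> {k \<in> K. f k > r}"
      then have "t \<le> f k" using t_le[of "f k"] f by auto
      then show "max s (f k) = f k" using s by simp
    qed simp
    finally show ?thesis by simp
  qed
  define s where "s = (r + t) / 2"
  have s: "r < s" "s < t" "s > 0" using t assms(2) by (auto simp: s_def)
  define B C where "B = (\<Prod>k\<in>{k \<in> K. b k > r}. b k)" and "C = (\<Prod>k\<in>{k \<in> K. c k > r}. c k)"
  have "B > 0" "C > 0" unfolding B_def C_def using assms(2) by (auto intro!: prod_pos)
  let ?m = "card {k \<in> K. b k \<le> r}" and ?n = "card {k \<in> K. c k \<le> r}"
  have e1: "s ^ ?m * B = s ^ ?n * C"
    using eq[of s] split[of s b] split[of s c] s by (simp add: B_def C_def)
  have e2: "t ^ ?m * B = t ^ ?n * C"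
    using eq[of t] split[of t b] split[of t c] t by (simp add: B_def C_def)
  have "(t ^ ?m * B) * (s ^ ?n * C) = (t ^ ?n * C) * (s ^ ?m * B)"
    using e1 e2 by simp
  then have "t ^ ?m * s ^ ?n = t ^ ?n * s ^ ?m" using \<open>B > 0\<close> \<open>C > 0\<close> by simp
  then have "(t / s) ^ ?m = (t / s) ^ ?n" using s by (simp add: power_divide field_simps)
  moreover have "t / s > 1" using s by simp
  ultimately show ?thesis by (simp add: power_inject_exp)
qed

context lemniscate
begin

text \<open>Several zeros may lie in one disc; the least index serves as the name of the disc, so
  that equal discs have equal names.\<close>

definition disc_index :: "('c poly \<Rightarrow> real) \<Rightarrow> nat" where
  "disc_index x = (LEAST i. i < N \<and> x (lin (\<rho> i)) \<le> rad i)"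

lemma disc_index:
  assumes "x \<in> berk_line av" "(\<Prod>j<N. x (lin (\<rho> j))) \<le> R"
  shows disc_index_less: "disc_index x < N" and disc_index_disc: "x (lin (\<rho> (disc_index x))) \<le> rad (disc_index x)"
  using LeastI_ex[of "\<lambda>i. i < N \<and> x (lin (\<rho> i)) \<le> rad i"] cover[OF assms] unfolding disc_index_def by auto

lemma rad_eq_of_common_point:
  assumes x: "x \<in> berk_line av" and i: "i < N" and j: "j < N"
    and "x (lin (\<rho> i)) \<le> rad i" "x (lin (\<rho> j)) \<le> rad j"
  shows "rad i = rad j" "av (\<rho> i - \<rho> j) \<le> rad i"
proof -
  have le: "av (\<rho> i - \<rho> j) \<le> max (rad i) (rad j)"
    using berk_lin_diff_le[OF x, of "\<rho> i" "\<rho> j"] assms by linarith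
  show *: "rad i = rad j"
  proof (cases "rad i \<le> rad j")
    case True
    then show ?thesis using rad_cong[OF j i] le by (simp add: av_minus_commute)
  next
    case False
    then show ?thesis using rad_cong[OF i j] le by simp
  qed
  show "av (\<rho> i - \<rho> j) \<le> rad i" using le * by simp
qed

lemma same_disc:
  assumes x: "x \<in> berk_line av" and y: "y \<in> berk_line av" and i: "i < N" and j: "j < N"
    and "x (lin (\<rho> i)) \<le> rad i" "x (lin (\<rho> j)) \<le> rad j" "y (lin (\<rho> i)) \<le> rad i"
  shows "y (lin (\<rho> j)) \<le> rad j"
  using rad_eq_of_common_point[OF x i j assms(5,6)] berk_lin_le[OF y, of "\<rho> j" "\<rho> i"] assms(7)
  by (simp add: av_minus_commute)

lemma disc_index_eq_iff:
  assumes x: "x \<in> berk_line av" "(\<Prod>j<N. x (lin (\<rho> j))) \<le> R"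
    and y: "y \<in> berk_line av" "(\<Prod>j<N. y (lin (\<rho> j))) \<le> R"
  shows "disc_index y = disc_index x \<longleftrightarrow> y (lin (\<rho> (disc_index x))) \<le> rad (disc_index x)"
proof
  assume "disc_index y = disc_index x"
  then show "y (lin (\<rho> (disc_index x))) \<le> rad (disc_index x)" using disc_index_disc[OF y] by simp
next
  assume le: "y (lin (\<rho> (disc_index x))) \<le> rad (disc_index x)"
  have "(i < N \<and> y (lin (\<rho> i)) \<le> rad i) \<longleftrightarrow> (i < N \<and> x (lin (\<rho> i)) \<le> rad i)" for i
    using same_disc[OF x(1) y(1) disc_index_less[OF x], of i] same_disc[OF y(1) x(1) disc_index_less[OF x], of i]
      disc_index_disc[OF x] le by blast
  then show "disc_index y = disc_index x" by (simp add: disc_index_def)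
qed

end

text \<open>Isolates what the capacity computation uses of the orbit polynomials. \<open>P n\<close>
  stands for \<open>orbit_poly d g (Suc n)\<close>, as index 0 is constant.\<close>

locale escape_tower = nonarch_field av for av :: "'c::alg_closed_field \<Rightarrow> real" +
  fixes P :: "nat \<Rightarrow> 'c poly" and d :: nat and R :: real
  assumes d: "d \<ge> 2" and R_ge_1: "R \<ge> 1"
    and monic: "Polynomial.lead_coeff (P n) = 1" "Polynomial.degree (P n) = d ^ n"
    and escape: "x \<in> berk_line av \<Longrightarrow> x (P n) > R \<Longrightarrow> x (P (Suc n)) = x (P n) ^ d"
begin

definition is_enum :: "nat \<Rightarrow> (nat \<Rightarrow> 'c) \<Rightarrow> bool" where
  "is_enum n \<rho> \<longleftrightarrow> P n = (\<Prod>i<d ^ n. lin (\<rho> i))"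

lemma enum_exists: "\<exists>\<rho>. is_enum n \<rho>"
proof -
  have "P n \<noteq> 0" using monic(1)[of n] by auto
  then obtain A where A: "size A = d ^ n" "P n = (\<Prod>x\<in>#A. lin x)"
    using alg_closed_imp_factorization[of "P n"] monic[of n] by auto
  obtain xs where xs: "mset xs = A" using ex_mset by blast
  have "P n = prod_list (map lin xs)" using A(2) by (simp flip: xs prod_mset_prod_list)
  also have "\<dots> = (\<Prod>i<d ^ n. lin (xs ! i))"
    using A(1) xs by (simp add: prod.list_conv_set_nth atLeast0LessThan flip: size_mset)
  finally show ?thesis unfolding is_enum_def by blast
qed

lemma enum_lemniscate: "lemniscate av (d ^ n) R"
  by unfold_locales (use d R_ge_1 in auto)

lemma enum_eval:
  assumes "is_enum n \<rho>" "x \<in> berk_line av"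
  shows "x (P n) = (\<Prod>i<d ^ n. x (lin (\<rho> i)))"
  using assms by (simp add: is_enum_def berk_prod)

lemma sublevel_decreasing:
  assumes "x \<in> berk_line av" "x (P (Suc n)) \<le> R"
  shows "x (P n) \<le> R"
proof (rule ccontr)
  assume "\<not> ?thesis"
  then have gt: "x (P n) > R" by simp
  have "x (P n) ^ 1 \<le> x (P n) ^ d" using gt R_ge_1 d by (intro power_increasing) auto
  then show False using escape[OF assms(1) gt] gt assms(2) by simp
qed

text \<open>On circles slightly larger than a disc of the \<open>n\<close>-th level the next polynomial has the absolute
  value of the \<open>d\<close>-th power of the \<open>n\<close>-th one, so it has \<open>d\<close> times as many zeros in the disc. Hence its
  zeros can be enumerated such that the \<open>k\<close>-th one lies in the disc around the \<open>k div d\<close>-th zero.\<close>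

lemma matching_exists:
  assumes \<rho>: "is_enum n \<rho>"
  shows "\<exists>\<rho>'. is_enum (Suc n) \<rho>' \<and>
    (\<forall>k<d ^ Suc n. av (\<rho>' k - \<rho> (k div d)) \<le> lemniscate.rad av \<rho> (d ^ n) R (k div d))"
proof -
  interpret L: lemniscate av \<rho> "d ^ n" R by (rule enum_lemniscate)
  let ?N = "d ^ n" and ?K = "{..<d ^ Suc n}"
  obtain \<beta> where \<beta>: "is_enum (Suc n) \<beta>" using enum_exists by blast
  have kdiv: "k div d < ?N" if "k < d ^ Suc n" for k
    using that d by (simp add: less_mult_imp_div_less mult.commute)
  have cov: "(\<Prod>j<?N. type1 av c (lin (\<rho> j))) \<le> R" if "poly (P n) c = 0 \<or> poly (P (Suc n)) c = 0" for c
  proof -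
    have "type1 av c (P n) \<le> R"
      using that sublevel_decreasing[OF type1_in_berk, of c n] R_ge_1 by (auto simp: type1_def)
    then show ?thesis using enum_eval[OF \<rho>, of "type1 av c"] by simp
  qed
  have zero_\<beta>: "poly (P (Suc n)) (\<beta> k) = 0" if "k < d ^ Suc n" for k
    using \<beta> that unfolding is_enum_def by (simp add: poly_prod del: power_Suc) auto
  have zero_\<rho>: "poly (P n) (\<rho> j) = 0" if "j < ?N" for j
    using \<rho> that unfolding is_enum_def by (simp add: poly_prod) auto
  \<comment> \<open>\<open>f\<close> names the level-n disc of each zero of the next polynomial;
    \<open>g\<close> runs through the zeros of \<open>P n\<close>, each taken \<open>d\<close>
    times, and names their discs.\<close>
  define f where "f k = L.disc_index (type1 av (\<beta> k))" for k
  define g where "g k = L.disc_index (type1 av (\<rho> (k div d)))" for k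
  have covf: "(\<Prod>j<?N. type1 av (\<beta> k) (lin (\<rho> j))) \<le> R" if "k < d ^ Suc n" for k
    using zero_\<beta>[OF that] by (intro cov) blast
  have covg: "(\<Prod>j<?N. type1 av (\<rho> (k div d)) (lin (\<rho> j))) \<le> R" if "k < d ^ Suc n" for k
    using zero_\<rho>[OF kdiv[OF that]] by (intro cov) blast
  have count: "card {k \<in> ?K. av (\<rho> i - \<beta> k) \<le> L.rad i} = card {k \<in> ?K. av (\<rho> i - \<rho> (k div d)) \<le> L.rad i}"
    if i: "i < ?N" for i
  proof (rule card_le_eq_of_prod_max_eq)
    fix s assume s: "s > L.rad i"
    then have s0: "s \<ge> 0" using L.rad_nonneg[OF i] by simp
    let ?x = "disc_point (\<rho> i) s"
    note x = disc_point_in_berk[OF s0, of "\<rho> i"] and xlin = disc_point_lin[OF s0, of "\<rho> i"]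
    have n: "?x (P n) = (\<Prod>j<?N. max s (av (\<rho> i - \<rho> j)))"
      by (simp add: enum_eval[OF \<rho> x] xlin)
    have "R < ?x (P n)"
      unfolding n using L.prod_max_strict_mono[OF i L.rad_nonneg[OF i] s] L.rad_prod[OF i] by simp
    then have "?x (P (Suc n)) = ?x (P n) ^ d" by (rule escape[OF x])
    also have "?x (P (Suc n)) = (\<Prod>k\<in>?K. max s (av (\<rho> i - \<beta> k)))"
      by (simp add: enum_eval[OF \<beta> x] xlin)
    also have "?x (P n) ^ d = (\<Prod>j<?N. \<Prod>_<d. max s (av (\<rho> i - \<rho> j)))"
      unfolding n by (simp add: prod_power_distrib)
    also have "\<dots> = (\<Prod>k<?N * d. max s (av (\<rho> i - \<rho> (k div d))))"
      by (rule prod.nat_div_group[symmetric])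
    finally show "(\<Prod>k\<in>?K. max s (av (\<rho> i - \<beta> k))) = (\<Prod>k\<in>?K. max s (av (\<rho> i - \<rho> (k div d))))"
      by (simp add: mult.commute)
  qed (use L.rad_nonneg[OF i] in auto)
  \<comment> \<open>Equal counts in every disc make the two families of names equal as multisets,
    which yields a permutation matching them.\<close>
  have "image_mset g (mset_set ?K) = image_mset f (mset_set ?K)"
  proof (rule multiset_eqI)
    fix v
    have "card {k \<in> ?K. f k = v} = card {k \<in> ?K. g k = v}"
    proof (cases "v \<in> f ` ?K \<union> g ` ?K")
      case True
      then obtain c where c: "v = L.disc_index (type1 av c)" "(\<Prod>j<?N. type1 av c (lin (\<rho> j))) \<le> R"
        unfolding f_def g_def using covf covg by blast
      have "{k \<in> ?K. f k = v} = {k \<in> ?K. av (\<rho> v - \<beta> k) \<le> L.rad v}"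
        unfolding c(1) f_def using L.disc_index_eq_iff[OF _ c(2) _ covf] by (auto simp: av_minus_commute)
      moreover have "{k \<in> ?K. g k = v} = {k \<in> ?K. av (\<rho> v - \<rho> (k div d)) \<le> L.rad v}"
        unfolding c(1) g_def using L.disc_index_eq_iff[OF _ c(2) _ covg] by (auto simp: av_minus_commute)
      moreover have "v < ?N" unfolding c(1) using c(2) by (intro L.disc_index_less) auto
      ultimately show ?thesis using count by simp
    next
      case False
      then have "{k \<in> ?K. f k = v} = {}" "{k \<in> ?K. g k = v} = {}" by auto
      then show ?thesis by (simp only:)
    qed
    moreover have "count (image_mset h (mset_set ?K)) v = card {k \<in> ?K. h k = v}" for h :: "nat \<Rightarrow> nat"
      by (simp add: count_image_mset_eq_card_vimage)
    ultimately show "count (image_mset g (mset_set ?K)) v = count (image_mset f (mset_set ?K)) v" by simp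
  qed
  then obtain \<pi> where \<pi>: "\<pi> permutes ?K" "\<forall>k\<in>?K. g k = f (\<pi> k)"
    by (rule image_mset_eq_implies_permutes[rotated]) auto
  have "is_enum (Suc n) (\<beta> \<circ> \<pi>)"
  proof -
    have "P (Suc n) = (\<Prod>k\<in>?K. lin (\<beta> k))" using \<beta> by (simp add: is_enum_def)
    also have "\<dots> = (\<Prod>k\<in>?K. lin (\<beta> (\<pi> k)))" by (subst prod.permute[OF \<pi>(1)]) (simp add: comp_def)
    finally show ?thesis by (simp add: is_enum_def)
  qed
  moreover have "av ((\<beta> \<circ> \<pi>) k - \<rho> (k div d)) \<le> L.rad (k div d)" if k: "k < d ^ Suc n" for k
  proof -
    have \<pi>k: "\<pi> k < d ^ Suc n" using permutes_in_image[OF \<pi>(1), of k] k by simp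
    let ?x = "type1 av (\<rho> (k div d))" and ?y = "type1 av (\<beta> (\<pi> k))"
    have "L.disc_index ?x = L.disc_index ?y" using \<pi>(2) k by (simp add: f_def g_def)
    then have "?y (lin (\<rho> (L.disc_index ?x))) \<le> L.rad (L.disc_index ?x)"
      using L.disc_index_disc[OF _ covf[OF \<pi>k]] by simp
    then have "?y (lin (\<rho> (k div d))) \<le> L.rad (k div d)"
      using L.same_disc[of ?x ?y "L.disc_index ?x" "k div d"] L.disc_index[OF _ covg[OF k]] kdiv[OF k]
        L.rad_nonneg[OF kdiv[OF k]] by simp
    then show ?thesis by simp
  qed
  ultimately show ?thesis by blast
qed

lemma nested_enum_exists:
  "\<exists>\<rho>. (\<forall>n. is_enum n (\<rho> n)) \<and>
     (\<forall>n. \<forall>k<d ^ Suc n. av (\<rho> (Suc n) k - \<rho> n (k div d)) \<le> lemniscate.rad av (\<rho> n) (d ^ n) R (k div d))"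
  using dependent_nat_choice[of is_enum "\<lambda>n \<rho> \<rho>'. \<forall>k<d ^ Suc n. av (\<rho>' k - \<rho> (k div d)) \<le> lemniscate.rad av \<rho> (d ^ n) R (k div d)"]
    enum_exists matching_exists by blast

end

section \<open>The equilibrium measure\<close>

lemma mem_cell_iff:
  fixes D t :: real
  assumes "D > 0"
  shows "t \<in> {real i / D..<(real i + 1) / D} \<longleftrightarrow> 0 \<le> t \<and> nat \<lfloor>t * D\<rfloor> = i"
proof -
  have "t \<in> {real i / D..<(real i + 1) / D} \<longleftrightarrow> \<lfloor>t * D\<rfloor> = int i"
    using assms by (simp add: floor_eq_iff field_simps)
  also have "\<dots> \<longleftrightarrow> 0 \<le> t \<and> nat \<lfloor>t * D\<rfloor> = i"
  proof -
    have "0 \<le> \<lfloor>t * D\<rfloor> \<longleftrightarrow> 0 \<le> t" using assms by (simp add: zero_le_mult_iff)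
    then show ?thesis by (cases "0 \<le> t") (auto simp: nat_eq_iff simp del: zero_le_floor)
  qed
  finally show ?thesis .
qed

locale marked_tower = escape_tower av P d R
  for av :: "'c::alg_closed_field \<Rightarrow> real" and P d R +
  fixes \<rho> :: "nat \<Rightarrow> nat \<Rightarrow> 'c"
  assumes enum: "is_enum n (\<rho> n)"
    and nested: "k < d ^ Suc n \<Longrightarrow>
      av (\<rho> (Suc n) k - \<rho> n (k div d)) \<le> lemniscate.rad av (\<rho> n) (d ^ n) R (k div d)"

sublocale marked_tower \<subseteq> L: lemniscate av "\<rho> n" "d ^ n" R for n
  by (rule enum_lemniscate)

context marked_tower
begin

section \<open>Nested discs, paths and their end points\<close>

definition limit_set :: "('c poly \<Rightarrow> real) set" where
  "limit_set = {x \<in> berk_line av. \<forall>n. x (P n) \<le> R}"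

lemma limit_set_berk: "x \<in> limit_set \<Longrightarrow> x \<in> berk_line av"
  by (simp add: limit_set_def)

lemma limit_set_prod:
  assumes "x \<in> limit_set"
  shows "(\<Prod>j<d ^ n. x (lin (\<rho> n j))) \<le> R"
proof -
  have "x (P n) \<le> R" using assms by (simp add: limit_set_def)
  then show ?thesis by (simp only: enum_eval[OF enum limit_set_berk[OF assms]])
qed

lemma div_less_level: "k < d ^ Suc n \<Longrightarrow> k div d < d ^ n"
  using d by (simp add: less_mult_imp_div_less mult.commute)

text \<open>If the new radius were larger, consider the point of the new disc: there
  \<open>P (Suc n)\<close> equals \<open>R\<close>, hence \<open>P n\<close> is at most
  \<open>R\<close>. But it is also the point of a disc around the old zero with more than the old
  radius, where \<open>P n\<close> exceeds \<open>R\<close>.\<close>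

lemma rad_Suc_le:
  assumes k: "k < d ^ Suc n"
  shows "L.rad (Suc n) k \<le> L.rad n (k div d)"
proof (rule ccontr)
  assume "\<not> ?thesis"
  then have less: "L.rad n (k div d) < L.rad (Suc n) k" by simp
  let ?s = "L.rad (Suc n) k" and ?i = "k div d"
  note i = div_less_level[OF k]
  note s0 = L.rad_nonneg[OF k]
  let ?x = "disc_point (\<rho> (Suc n) k) ?s"
  note x = disc_point_in_berk[OF s0, of "\<rho> (Suc n) k"] and xlin = disc_point_lin[OF s0, of "\<rho> (Suc n) k"]
  have "?x (P (Suc n)) = R"
    unfolding enum_eval[OF enum x] xlin by (rule L.rad_prod[OF k])
  then have "?x (P n) \<le> R" using sublevel_decreasing[OF x] by simp
  moreover have "?x (P n) = (\<Prod>j<d ^ n. max ?s (av (\<rho> n ?i - \<rho> n j)))"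
    unfolding enum_eval[OF enum x] xlin using nested[OF k] less
    by (intro prod.cong refl L.max_av_cong) simp
  moreover have "R < (\<Prod>j<d ^ n. max ?s (av (\<rho> n ?i - \<rho> n j)))"
    using L.prod_max_strict_mono[OF i L.rad_nonneg[OF i] less] L.rad_prod[OF i] by simp
  ultimately show False by simp
qed

text \<open>The interval \<open>[0, 1)\<close> with its \<open>d\<close>-adic subdivisions serves as the space of paths in the tree of
  discs. The limit point of a path exists also if its discs have empty intersection in \<open>'c\<close>.\<close>

definition cell_index :: "nat \<Rightarrow> real \<Rightarrow> nat" where
  "cell_index n t = nat \<lfloor>t * real d ^ n\<rfloor>"

lemma cell_index_less:
  assumes "t \<in> {0..<1}"
  shows "cell_index n t < d ^ n"
proof -
  have "t * real d ^ n < 1 * real d ^ n" using assms d by (intro mult_strict_right_mono) auto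
  then have "\<lfloor>t * real d ^ n\<rfloor> < int (d ^ n)" by (simp add: floor_less_iff)
  moreover have "0 \<le> \<lfloor>t * real d ^ n\<rfloor>" using assms by simp
  ultimately show ?thesis by (simp add: cell_index_def nat_less_iff)
qed

text \<open>Division by \<open>d\<close> is also the rule by which \<open>nested\<close> assigns a
  zero to a disc of the previous level, so a path through the cells follows nested discs.\<close>

lemma cell_index_Suc_div:
  assumes "t \<in> {0..<1}"
  shows "cell_index (Suc n) t div d = cell_index n t"
proof -
  have "\<lfloor>t * real d ^ Suc n\<rfloor> div int d = \<lfloor>t * real d ^ Suc n / real_of_int (int d)\<rfloor>"
    by (rule floor_divide_real_eq_div[symmetric]) simp
  also have "t * real d ^ Suc n / real_of_int (int d) = t * real d ^ n" using d by simp
  finally have "\<lfloor>t * real d ^ Suc n\<rfloor> div int d = \<lfloor>t * real d ^ n\<rfloor>" .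
  moreover have "nat \<lfloor>t * real d ^ Suc n\<rfloor> div d = nat (\<lfloor>t * real d ^ Suc n\<rfloor> div int d)"
    using assms by (simp add: nat_div_distrib)
  ultimately show ?thesis by (simp add: cell_index_def)
qed

lemma cell_index_mono_eq:
  assumes "s \<in> {0..<1}" "t \<in> {0..<1}" "cell_index n s = cell_index n t" "m \<le> n"
  shows "cell_index m s = cell_index m t"
  using assms(4,3)
proof (induction rule: dec_induct)
  case (step k)
  then show ?case using cell_index_Suc_div[OF assms(1), of k] cell_index_Suc_div[OF assms(2), of k] by metis
qed

definition path_disc :: "nat \<Rightarrow> real \<Rightarrow> 'c poly \<Rightarrow> real" where
  "path_disc n t = disc_point (\<rho> n (cell_index n t)) (L.rad n (cell_index n t))"

lemma path_disc:
  assumes "t \<in> {0..<1}"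
  shows path_disc_berk: "path_disc n t \<in> berk_line av"
    and path_disc_lin: "path_disc n t (lin a) = max (L.rad n (cell_index n t)) (av (\<rho> n (cell_index n t) - a))"
  unfolding path_disc_def using disc_point_in_berk disc_point_lin L.rad_nonneg[OF cell_index_less[OF assms]] by blast+

lemma path_disc_Suc_le:
  assumes t: "t \<in> {0..<1}"
  shows "path_disc (Suc n) t (lin a) \<le> path_disc n t (lin a)"
proof -
  note k = cell_index_less[OF t, of "Suc n"]
  show ?thesis
    unfolding path_disc_lin[OF t]
    using rad_Suc_le[OF k] nested[OF k] av_ultra[of "\<rho> (Suc n) (cell_index (Suc n) t)" a "\<rho> n (cell_index n t)"]
    by (simp add: cell_index_Suc_div[OF t])  linarith
qed

lemma limit_point_exists:
  assumes t: "t \<in> {0..<1}"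
  shows "\<exists>x\<in>berk_line av. \<forall>a. (\<lambda>n. path_disc n t (lin a)) \<longlonglongrightarrow> x (lin a)"
proof -
  have "\<exists>l. (\<lambda>n. path_disc n t (lin a)) \<longlonglongrightarrow> l" for a
  proof -
    have "decseq (\<lambda>n. path_disc n t (lin a))" by (intro decseq_SucI path_disc_Suc_le t)
    then show ?thesis
      using decseq_convergent[of "\<lambda>n. path_disc n t (lin a)" 0] berk_nonneg[OF path_disc_berk[OF t]] by metis
  qed
  then obtain l where l: "\<And>a. (\<lambda>n. path_disc n t (lin a)) \<longlonglongrightarrow> l a" by metis
  obtain x where "x \<in> berk_line av" "\<forall>a. x (lin a) = l a"
    using berk_limit_exists[where y = "\<lambda>n. path_disc n t", OF _ path_disc_berk[OF t] l] by auto
  then show ?thesis using l by (intro bexI[of _ x]) auto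
qed

definition end_pt :: "real \<Rightarrow> 'c poly \<Rightarrow> real" where
  "end_pt t = (SOME x. x \<in> berk_line av \<and> (\<forall>a. (\<lambda>n. path_disc n t (lin a)) \<longlonglongrightarrow> x (lin a)))"

lemma end_pt:
  assumes "t \<in> {0..<1}"
  shows end_pt_berk: "end_pt t \<in> berk_line av" and end_pt_lim: "(\<lambda>n. path_disc n t (lin a)) \<longlonglongrightarrow> end_pt t (lin a)"
  using someI_ex[of "\<lambda>x. x \<in> berk_line av \<and> (\<forall>a. (\<lambda>n. path_disc n t (lin a)) \<longlonglongrightarrow> x (lin a))"]
    limit_point_exists[OF assms] unfolding end_pt_def by blast+

lemma end_pt_lin_le:
  assumes "t \<in> {0..<1}"
  shows "end_pt t (lin a) \<le> path_disc n t (lin a)"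
  by (rule decseq_ge[OF decseq_SucI end_pt_lim]) (use path_disc_Suc_le assms in auto)

lemma end_pt_le:
  assumes "t \<in> {0..<1}"
  shows "end_pt t f \<le> path_disc n t f"
  by (rule berk_mono[OF end_pt_berk path_disc_berk end_pt_lin_le]) (use assms in auto)

lemma end_pt_in_limit_set:
  assumes t: "t \<in> {0..<1}"
  shows "end_pt t \<in> limit_set"
proof -
  have "end_pt t (P n) \<le> R" for n
  proof -
    have "path_disc n t (P n) = R"
      unfolding enum_eval[OF enum path_disc_berk[OF t]] path_disc_lin[OF t] by (rule L.rad_prod[OF cell_index_less[OF t]])
    then show ?thesis using end_pt_le[OF t, of "P n" n] by simp
  qed
  then show ?thesis using end_pt_berk[OF t] by (simp add: limit_set_def)
qed

lemma end_pt_lin_eq: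
  assumes t: "t \<in> {0..<1}" and "L.rad n (cell_index n t) < av (\<rho> n (cell_index n t) - a)"
  shows "end_pt t (lin a) = av (\<rho> n (cell_index n t) - a)"
proof -
  have "end_pt t (lin (\<rho> n (cell_index n t))) \<le> L.rad n (cell_index n t)"
    using end_pt_lin_le[OF t, of "\<rho> n (cell_index n t)" n] L.rad_nonneg[OF cell_index_less[OF t]] by (simp add: path_disc_lin[OF t])
  then show ?thesis
    using berk_lin_eq[OF end_pt_berk[OF t], of "\<rho> n (cell_index n t)" a] assms(2) by (simp add: av_minus_commute)
qed

text \<open>If \<open>a\<close> lies in all discs of the path of \<open>t\<close>, no other path
  comes closer to it: on each level the other disc either coincides with that of \<open>t\<close> or
  is farther from \<open>a\<close> than the radius.\<close>

lemma end_pt_lin_le_of_central: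
  assumes s: "s \<in> {0..<1}" and t: "t \<in> {0..<1}"
    and central: "\<And>n. av (\<rho> n (cell_index n t) - a) \<le> L.rad n (cell_index n t)"
  shows "end_pt t (lin a) \<le> end_pt s (lin a)"
proof (rule LIMSEQ_le_const[OF end_pt_lim[OF s]], intro exI allI impI)
  fix n
  let ?i = "cell_index n t" and ?j = "cell_index n s"
  have "end_pt t (lin a) \<le> L.rad n ?i" using end_pt_lin_le[OF t, of a n] central[of n] by (simp add: path_disc_lin[OF t])
  also have "\<dots> \<le> path_disc n s (lin a)"
  proof (cases "av (\<rho> n ?i - \<rho> n ?j) \<le> L.rad n ?i")
    case True
    then show ?thesis using L.rad_cong[OF cell_index_less[OF t] cell_index_less[OF s] True] by (simp add: path_disc_lin[OF s])
  next
    case False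
    then show ?thesis
      using av_ultra[of "\<rho> n ?i" "\<rho> n ?j" a] central[of n] by (simp add: path_disc_lin[OF s] av_minus_commute)
  qed
  finally show "end_pt t (lin a) \<le> path_disc n s (lin a)" .
qed

text \<open>Continuity refers to the tree topology, in which \<open>s n\<close> shares the level-n
  cell of \<open>t\<close>, not to that of the real line. If \<open>a\<close> leaves the discs of
  \<open>t\<close>, the values become constant; otherwise they lie between the value at
  \<open>t\<close> and those of the disc points.\<close>

lemma end_pt_continuous:
  assumes t: "t \<in> {0..<1}" and s: "\<And>n. s n \<in> {0..<1}" and eq: "\<And>n. cell_index n (s n) = cell_index n t"
  shows "(\<lambda>n. end_pt (s n)) \<longlonglongrightarrow> end_pt t"
proof -
  define y where "y n = end_pt (s n)" for n
  have y: "y n \<in> berk_line av" for n unfolding y_def by (rule end_pt_berk[OF s])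
  have "(\<lambda>n. y n (lin a)) \<longlonglongrightarrow> end_pt t (lin a)" for a
  proof (cases "\<exists>m. L.rad m (cell_index m t) < av (\<rho> m (cell_index m t) - a)")
    case True
    then obtain m where m: "L.rad m (cell_index m t) < av (\<rho> m (cell_index m t) - a)" by blast
    have "y n (lin a) = end_pt t (lin a)" if "n \<ge> m" for n
    proof -
      have "cell_index m (s n) = cell_index m t" by (rule cell_index_mono_eq[OF s t eq that])
      then show ?thesis using end_pt_lin_eq[OF s, of m n a] end_pt_lin_eq[OF t m] m by (simp add: y_def)
    qed
    then have "\<forall>\<^sub>F n in sequentially. end_pt t (lin a) = y n (lin a)"
      by (auto simp: eventually_sequentially intro!: exI[of _ m])
    then show ?thesis by (rule Lim_transform_eventually[OF tendsto_const])
  next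
    case False
    then have central: "av (\<rho> n (cell_index n t) - a) \<le> L.rad n (cell_index n t)" for n by (simp add: not_less)
    show ?thesis
    proof (rule tendsto_sandwich)
      show "\<forall>\<^sub>F n in sequentially. end_pt t (lin a) \<le> y n (lin a)"
        unfolding y_def by (intro always_eventually allI end_pt_lin_le_of_central[OF s t central])
      have "y n (lin a) \<le> path_disc n t (lin a)" for n
        using end_pt_lin_le[OF s, of n a n] by (simp add: y_def path_disc_def eq)
      then show "\<forall>\<^sub>F n in sequentially. y n (lin a) \<le> path_disc n t (lin a)" by simp
    qed (use end_pt_lim[OF t] in auto)
  qed
  then have "y \<longlonglongrightarrow> end_pt t" by (rule berk_tendsto[OF end_pt_berk[OF t] y])
  then show ?thesis by (simp add: y_def[abs_def])
qed

section \<open>The image of Lebesgue measure under the end point map\<close>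

definition unit_measure :: "real measure" where
  "unit_measure = restrict_space lborel {0..<1}"

lemma space_unit_measure [simp]: "space unit_measure = {0..<1}"
  by (simp add: unit_measure_def)

lemma cell_index_measurable [measurable]: "cell_index n \<in> measurable unit_measure (count_space UNIV)"
  unfolding unit_measure_def cell_index_def by (rule measurable_restrict_space1) measurable

text \<open>The topology need not have a countable base, so arbitrary open sets are treated
  directly: by continuity along the tree the preimage is a union of cells, of which there are only
  countably many.\<close>

lemma end_pt_measurable_borel: "end_pt \<in> borel_measurable unit_measure"
proof (rule borel_measurableI)
  fix S :: "('c poly \<Rightarrow> real) set" assume "open S"
  define cell where "cell n i = cell_index n -` {i} \<inter> space unit_measure" for n i
  define J where "J = {(n, i). end_pt ` cell n i \<subseteq> S}"
  have "end_pt -` S \<inter> space unit_measure = (\<Union>(n, i)\<in>J. cell n i)"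
  proof (intro equalityI subsetI)
    fix t assume "t \<in> end_pt -` S \<inter> space unit_measure"
    then have t: "end_pt t \<in> S" "t \<in> {0..<1}" by auto
    have "\<exists>n. end_pt ` cell n (cell_index n t) \<subseteq> S"
    proof (rule ccontr)
      assume "\<not> ?thesis"
      then have "\<forall>n. \<exists>s. s \<in> {0..<1} \<and> cell_index n s = cell_index n t \<and> end_pt s \<notin> S"
        by (force simp: cell_def image_subset_iff)
      then obtain s where s: "\<And>n. s n \<in> {0..<1}" "\<And>n. cell_index n (s n) = cell_index n t" "\<And>n. end_pt (s n) \<notin> S" by metis
      have "(\<lambda>n. end_pt (s n)) \<longlonglongrightarrow> end_pt t" by (rule end_pt_continuous[OF t(2) s(1,2)])
      then have "\<forall>\<^sub>F n in sequentially. end_pt (s n) \<in> S" using \<open>open S\<close> t(1) by (rule topological_tendstoD)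
      then show False using s(3) by simp
    qed
    then obtain n where "end_pt ` cell n (cell_index n t) \<subseteq> S" by blast
    then have "(n, cell_index n t) \<in> J" "t \<in> cell n (cell_index n t)" using t by (auto simp: J_def cell_def)
    then show "t \<in> (\<Union>(n, i)\<in>J. cell n i)" by blast
  next
    fix t assume "t \<in> (\<Union>(n, i)\<in>J. cell n i)"
    then show "t \<in> end_pt -` S \<inter> space unit_measure" by (fastforce simp: J_def cell_def)
  qed
  also have "\<dots> \<in> sets unit_measure"
  proof (rule sets.countable_UN'')
    fix p assume "p \<in> J"
    show "(case p of (n, i) \<Rightarrow> cell n i) \<in> sets unit_measure"
      unfolding cell_def by (cases p) (simp only: split_conv, rule measurable_sets[OF cell_index_measurable], simp)
  qed simp
  finally show "end_pt -` S \<inter> space unit_measure \<in> sets unit_measure" .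
qed

lemma end_pt_measurable: "end_pt \<in> measurable unit_measure (restrict_space borel limit_set)"
  by (rule measurable_restrict_space2[OF _ end_pt_measurable_borel]) (use end_pt_in_limit_set in auto)

lemma prob_unit_measure: "prob_space unit_measure"
  by (rule prob_spaceI) (simp add: unit_measure_def emeasure_restrict_space space_restrict_space)

definition equilibrium :: "('c poly \<Rightarrow> real) measure" where
  "equilibrium = distr unit_measure (restrict_space borel limit_set) end_pt"

lemma equilibrium_in: "equilibrium \<in> prob_measures_on limit_set"
  unfolding prob_measures_on_def equilibrium_def
  using prob_space.prob_space_distr[OF prob_unit_measure end_pt_measurable] by simp

lemma nn_integral_cell_index:
  fixes g :: "nat \<Rightarrow> ennreal"
  shows "(\<integral>\<^sup>+ t. g (cell_index n t) \<partial>unit_measure) = (\<Sum>i<d ^ n. g i * ennreal (1 / real d ^ n))"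
proof -
  let ?D = "real d ^ n"
  let ?I = "\<lambda>i. {real i / ?D..<(real i + 1) / ?D}"
  have D: "?D > 0" using d by simp
  have "(\<integral>\<^sup>+ t. g (cell_index n t) \<partial>unit_measure) = (\<integral>\<^sup>+ t. g (cell_index n t) * indicator {0..<1} t \<partial>lborel)"
    unfolding unit_measure_def by (subst nn_integral_restrict_space) (auto simp: indicator_def intro!: nn_integral_cong)
  also have "\<dots> = (\<integral>\<^sup>+ t. (\<Sum>i<d ^ n. g i * indicator (?I i) t) \<partial>lborel)"
  proof (rule nn_integral_cong)
    fix t :: real
    have mem: "t \<in> ?I i \<longleftrightarrow> 0 \<le> t \<and> cell_index n t = i" for i
      unfolding cell_index_def by (rule mem_cell_iff[OF D])
    show "g (cell_index n t) * indicator {0..<1} t = (\<Sum>i<d ^ n. g i * indicator (?I i) t)"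
    proof (cases "t \<in> {0..<1}")
      case True
      have "(\<Sum>i<d ^ n. g i * indicator (?I i) t) = (\<Sum>i\<in>{cell_index n t}. g i * indicator (?I i) t)"
        using cell_index_less[OF True, of n] mem by (intro sum.mono_neutral_right) (auto simp: indicator_def)
      also have "\<dots> = g (cell_index n t)" using mem[of "cell_index n t"] True by (simp add: indicator_def)
      finally show ?thesis using True by simp
    next
      case False
      have "t \<notin> ?I i" if i: "i < d ^ n" for i
      proof
        assume "t \<in> ?I i"
        moreover have "real (i + 1) \<le> real (d ^ n)" using i by (subst of_nat_le_iff) simp
        then have "(real i + 1) / ?D \<le> 1" using D by simp
        moreover have "real i / ?D \<ge> 0" using D by (intro divide_nonneg_pos) auto
        ultimately show False using False by (simp only: atLeastLessThan_iff) linarith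
      qed
      then have "(\<Sum>i<d ^ n. g i * indicator (?I i) t) = 0" by (intro sum.neutral) simp
      then show ?thesis using False by simp
    qed
  qed
  also have "\<dots> = (\<Sum>i<d ^ n. g i * emeasure lborel (?I i))"
    by (subst nn_integral_sum) (auto simp: nn_integral_cmult_indicator)
  also have "\<dots> = (\<Sum>i<d ^ n. g i * ennreal (1 / ?D))"
  proof (intro sum.cong refl)
    fix i
    have "real i / ?D \<le> (real i + 1) / ?D" using D by (simp add: divide_right_mono)
    moreover have "(real i + 1) / ?D - real i / ?D = 1 / ?D" by (simp add: diff_divide_distrib[symmetric])
    ultimately show "g i * emeasure lborel (?I i) = g i * ennreal (1 / ?D)" by simp
  qed
  finally show ?thesis .
qed

text \<open>The level-n approximation of the Hsia kernel of \<open>end_pt t\<close> and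
  \<open>y\<close>. Here \<open>y\<close> may be any point of the limit set, so its disc is found by
  \<open>disc_index\<close> and not from a path.\<close>

definition path_dist :: "nat \<Rightarrow> real \<Rightarrow> ('c poly \<Rightarrow> real) \<Rightarrow> real" where
  "path_dist n t y = L.disc_dist n (cell_index n t) (L.disc_index n y)"

lemma disc_index_limit_set:
  assumes "y \<in> limit_set"
  shows disc_index_limit_set_less: "L.disc_index n y < d ^ n" and disc_index_limit_set_disc: "y (lin (\<rho> n (L.disc_index n y))) \<le> L.rad n (L.disc_index n y)"
  using L.disc_index_less[OF limit_set_berk limit_set_prod, OF assms assms] L.disc_index_disc[OF limit_set_berk limit_set_prod, OF assms assms] by auto

lemma path_dist_pos: "t \<in> {0..<1} \<Longrightarrow> path_dist n t y > 0"
  unfolding path_dist_def by (rule L.disc_dist_pos[OF cell_index_less])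

lemma path_dist_Suc_le:
  assumes t: "t \<in> {0..<1}" and y: "y \<in> limit_set"
  shows "path_dist (Suc n) t y \<le> path_dist n t y"
proof -
  let ?i = "cell_index (Suc n) t" and ?j = "L.disc_index (Suc n) y" and ?jn = "L.disc_index n y"
  note i = cell_index_less[OF t, of "Suc n"] and j = disc_index_limit_set_less[OF y, of "Suc n"] and j0 = disc_index_limit_set_less[OF y, of n]
  have yj: "y (lin (\<rho> n (?j div d))) \<le> L.rad n (?j div d)"
    using berk_lin_le[OF limit_set_berk[OF y], of "\<rho> n (?j div d)" "\<rho> (Suc n) ?j"] nested[OF j] rad_Suc_le[OF j]
      disc_index_limit_set_disc[OF y, of "Suc n"] by (simp only: av_minus_commute)
  have "path_dist (Suc n) t y \<le> L.disc_dist n (?i div d) (?j div d)"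
  proof -
    have "av (\<rho> (Suc n) ?i - \<rho> (Suc n) ?j) \<le>
        max (max (L.rad n (?i div d)) (av (\<rho> n (?i div d) - \<rho> n (?j div d)))) (L.rad n (?j div d))"
      using av_ultra[of "\<rho> (Suc n) ?i" "\<rho> (Suc n) ?j" "\<rho> n (?i div d)"]
        av_ultra[of "\<rho> n (?i div d)" "\<rho> (Suc n) ?j" "\<rho> n (?j div d)"] nested[OF i] nested[OF j]
      unfolding av_minus_commute[of "\<rho> n (?j div d)"] by linarith
    also have "\<dots> \<le> L.disc_dist n (?i div d) (?j div d)"
      using L.rad_le_disc_dist[OF div_less_level[OF i] div_less_level[OF j]] by (simp add: L.disc_dist_def)
    finally show ?thesis
      unfolding path_dist_def L.disc_dist_def[of "Suc n"]
      using rad_Suc_le[OF i] L.rad_le_disc_dist(1)[OF div_less_level[OF i] div_less_level[OF j]] by simp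
  qed
  also have "\<dots> = L.disc_dist n (cell_index n t) (?j div d)" by (simp only: cell_index_Suc_div[OF t])
  also have "\<dots> = L.disc_dist n (?j div d) (cell_index n t)"
    by (rule L.disc_dist_sym[OF cell_index_less[OF t] div_less_level[OF j]])
  \<comment> \<open>\<open>?j div d\<close> need not be the least index of its disc. Both indices
    have discs containing \<open>y\<close>, hence the same disc.\<close>
  also have "\<dots> = L.disc_dist n ?jn (cell_index n t)"
    by (rule L.disc_dist_cong[OF div_less_level[OF j] j0 
          L.rad_eq_of_common_point(2)[OF limit_set_berk[OF y] div_less_level[OF j] j0 yj disc_index_limit_set_disc[OF y]]])
  also have "\<dots> = path_dist n t y" unfolding path_dist_def by (rule L.disc_dist_sym[OF j0 cell_index_less[OF t]])
  finally show ?thesis .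
qed

text \<open>On level 0 there is a single zero, whose disc has radius at most \<open>R\<close>. The
  bound makes \<open>ln R - ln (path_dist n t y)\<close> nonnegative, as integration in
  \<open>ennreal\<close> demands.\<close>

lemma path_dist_le_R:
  assumes t: "t \<in> {0..<1}" and y: "y \<in> limit_set"
  shows "path_dist n t y \<le> R"
proof (induction n)
  case 0
  have pos: "0 < d ^ 0" by simp
  have "cell_index 0 t < 1" "L.disc_index 0 y < 1"
    using cell_index_less[OF t, of 0] disc_index_limit_set_less[OF y, of 0] by (simp_all only: power_0)
  then have "path_dist 0 t y = L.disc_dist 0 0 0" by (simp only: path_dist_def less_one)
  also have "\<dots> = max (L.rad 0 0) 0" by (simp only: L.disc_dist_def diff_self av_0)
  also have "\<dots> \<le> R" using L.rad_le[OF pos] R_ge_1 by linarith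
  finally show ?case .
next
  case (Suc n)
  then show ?case using path_dist_Suc_le[OF t y, of n] by simp
qed

text \<open>For each centre \<open>a\<close> the level-n distance is at most the larger of the
  distances from \<open>a\<close> to the disc of \<open>t\<close> and to \<open>y\<close>. Only the
  former changes with \<open>n\<close>, and it tends to the distance from the end point.\<close>

lemma hsia_ge_of_path_dist:
  assumes t: "t \<in> {0..<1}" and y: "y \<in> limit_set" and c: "\<And>n. c \<le> path_dist n t y"
  shows "c \<le> hsia_inf (end_pt t) y"
proof (rule hsia_inf_ge)
  fix a
  show "c \<le> max (end_pt t (lin a)) (y (lin a))"
  proof (rule LIMSEQ_le_const[OF tendsto_max[OF end_pt_lim[OF t] tendsto_const]], intro exI allI impI)
    fix n
    let ?i = "cell_index n t" and ?j = "L.disc_index n y"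
    have "path_dist n t y \<le> max (path_disc n t (lin a)) (y (lin a))"
    proof (cases "av (\<rho> n ?i - \<rho> n ?j) \<le> L.rad n ?i")
      case True
      then show ?thesis by (simp add: path_dist_def L.disc_dist_def path_disc_lin[OF t] le_max_iff_disj)
    next
      case False
      then have "path_dist n t y = av (\<rho> n ?i - \<rho> n ?j)" by (simp add: path_dist_def L.disc_dist_def)
      moreover have "L.rad n ?j < av (\<rho> n ?i - \<rho> n ?j)"
      proof (rule ccontr)
        assume "\<not> ?thesis"
        then have "L.rad n ?i = L.rad n ?j"
          using L.rad_cong[OF disc_index_limit_set_less[OF y] cell_index_less[OF t]] by (simp add: av_minus_commute)
        then show False using False \<open>\<not> L.rad n ?j < _\<close> by simp
      qed
      moreover have "av (a - \<rho> n ?j) \<le> max (y (lin a)) (L.rad n ?j)"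
        using berk_lin_diff_le[OF limit_set_berk[OF y], of a "\<rho> n ?j"] disc_index_limit_set_disc[OF y, of n] by linarith
      ultimately show ?thesis
        using av_ultra[of "\<rho> n ?i" "\<rho> n ?j" a] unfolding path_disc_lin[OF t] by linarith
    qed
    then show "c \<le> max (path_disc n t (lin a)) (y (lin a))" using c[of n] by simp
  qed
qed

end

section \<open>Energies\<close>

text \<open>Stated for arbitrary functions, since in the energy it is applied to the potential as a
  function of \<open>y\<close>, whose measurability is not established.\<close>

lemma ereal_integral_mono:
  assumes "\<And>x. x \<in> space \<mu> \<Longrightarrow> f x \<le> g x"
  shows "ereal_integral \<mu> f \<le> ereal_integral \<mu> g"
  unfolding ereal_integral_def
  by (intro ereal_minus_mono less_eq_ennreal.rep_eq[THEN iffD1] nn_integral_mono e2ennreal_mono)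
     (use assms in \<open>auto simp: ereal_minus_le_minus\<close>)

lemma ereal_integral_ereal:
  assumes "integrable \<mu> f"
  shows "ereal_integral \<mu> (\<lambda>x. ereal (f x)) = ereal (integral\<^sup>L \<mu> f)"
proof -
  have fin: "(\<integral>\<^sup>+ x. ennreal (f x) \<partial>\<mu>) \<noteq> \<infinity>" "(\<integral>\<^sup>+ x. ennreal (- f x) \<partial>\<mu>) \<noteq> \<infinity>"
    using assms by (auto simp: real_integrable_def)
  have e: "e2ennreal (ereal r) = ennreal r" for r by (rule e2ennreal_ereal)
  have enn: "enn2ereal a = ereal (enn2real a)" if "a \<noteq> \<infinity>" for a
    using that by (cases a) (auto simp: enn2ereal_ennreal)
  show ?thesis
    unfolding ereal_integral_def real_lebesgue_integral_def[OF assms]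
    using enn[OF fin(1)] enn[OF fin(2)] by (simp add: e)
qed

text \<open>The assumption on the shifted function expresses a nonpositive integral without infinite
  differences. Pointwise the positive part plus \<open>C\<close> is the shifted function plus the
  negative part; integrating and cancelling \<open>C\<close> compares the two parts.\<close>

lemma ereal_integral_nonpos:
  assumes "prob_space \<mu>" and f[measurable]: "f \<in> borel_measurable \<mu>" and "C \<ge> 0"
    and bound: "\<And>x. x \<in> space \<mu> \<Longrightarrow> - ereal C \<le> f x"
    and int: "(\<integral>\<^sup>+ x. e2ennreal (f x + ereal C) \<partial>\<mu>) \<le> ennreal C"
  shows "ereal_integral \<mu> f \<le> 0"
proof -
  interpret prob_space \<mu> by fact
  let ?p = "\<lambda>x. e2ennreal (f x)" and ?n = "\<lambda>x. e2ennreal (- f x)"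
  have pt: "?p x + ennreal C = e2ennreal (f x + ereal C) + ?n x" if x: "x \<in> space \<mu>" for x
  proof (cases "f x")
    case (real r)
    then have "- C \<le> r" using bound[OF x] by simp
    then show ?thesis
      using real \<open>C \<ge> 0\<close> by (cases "r \<ge> 0") (auto simp: e2ennreal_ereal ennreal_neg simp flip: ennreal_plus)
  next
    case PInf
    then show ?thesis by (simp add: e2ennreal_infty e2ennreal_neg)
  next
    case MInf
    then show ?thesis using bound[OF x] by simp
  qed
  have n_le: "?n x \<le> ennreal C" if x: "x \<in> space \<mu>" for x
  proof -
    have "- f x \<le> ereal C" using bound[OF x] by (simp add: ereal_uminus_le_reorder)
    then show ?thesis using e2ennreal_mono by (metis e2ennreal_ereal)
  qed
  have "(\<integral>\<^sup>+ x. ?n x \<partial>\<mu>) \<le> (\<integral>\<^sup>+ x. ennreal C \<partial>\<mu>)" by (intro nn_integral_mono n_le)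
  also have "\<dots> = ennreal C" by (simp add: emeasure_space_1)
  finally have n_fin: "(\<integral>\<^sup>+ x. ?n x \<partial>\<mu>) \<noteq> \<infinity>" by (auto simp: top_unique)
  have "(\<integral>\<^sup>+ x. ?p x \<partial>\<mu>) + ennreal C = (\<integral>\<^sup>+ x. ?p x + ennreal C \<partial>\<mu>)"
    by (subst nn_integral_add) (auto simp: emeasure_space_1)
  also have "\<dots> = (\<integral>\<^sup>+ x. e2ennreal (f x + ereal C) + ?n x \<partial>\<mu>)"
    by (rule nn_integral_cong) (rule pt)
  also have "\<dots> = (\<integral>\<^sup>+ x. e2ennreal (f x + ereal C) \<partial>\<mu>) + (\<integral>\<^sup>+ x. ?n x \<partial>\<mu>)"
    by (rule nn_integral_add) auto
  also have "\<dots> \<le> ennreal C + (\<integral>\<^sup>+ x. ?n x \<partial>\<mu>)" by (intro add_right_mono int)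
  finally have "ennreal C + (\<integral>\<^sup>+ x. ?p x \<partial>\<mu>) \<le> ennreal C + (\<integral>\<^sup>+ x. ?n x \<partial>\<mu>)" by (simp add: add.commute)
  then have le: "(\<integral>\<^sup>+ x. ?p x \<partial>\<mu>) \<le> (\<integral>\<^sup>+ x. ?n x \<partial>\<mu>)" by (simp add: ennreal_add_left_cancel_le)
  then have "enn2ereal (\<integral>\<^sup>+ x. ?p x \<partial>\<mu>) \<le> enn2ereal (\<integral>\<^sup>+ x. ?n x \<partial>\<mu>)" by (rule less_eq_ennreal.rep_eq[THEN iffD1])
  moreover have "\<bar>enn2ereal (\<integral>\<^sup>+ x. ?n x \<partial>\<mu>)\<bar> \<noteq> \<infinity>"
    using n_fin by (cases "(\<integral>\<^sup>+ x. ?n x \<partial>\<mu>)") (auto simp: enn2ereal_ennreal)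
  ultimately show ?thesis
    unfolding ereal_integral_def by (cases "enn2ereal (\<integral>\<^sup>+ x. ?n x \<partial>\<mu>)"; cases "enn2ereal (\<integral>\<^sup>+ x. ?p x \<partial>\<mu>)") auto
qed

lemma measurable_neg_log [measurable]: "neg_log \<in> borel_measurable borel"
  unfolding neg_log_def by measurable

lemma neg_log_antimono:
  assumes "0 \<le> a" "a \<le> b" "0 < b"
  shows "ereal (- ln b) \<le> neg_log a"
  using assms by (auto simp: neg_log_def)

context nonarch_field
begin

lemma hsia_inf_nonneg:
  assumes "x \<in> berk_line av"
  shows "0 \<le> hsia_inf x y"
  by (rule hsia_inf_ge) (use berk_nonneg[OF assms] in \<open>auto simp: le_max_iff_disj\<close>)

text \<open>The value is below \<open>c\<close> iff some centre witnesses it, so strict sublevel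
  sets are relatively open. The union over the centres may be uncountable.\<close>

lemma hsia_inf_measurable:
  assumes "E \<subseteq> berk_line av"
  shows "(\<lambda>x. hsia_inf x y) \<in> borel_measurable (restrict_space borel E)"
proof (rule borel_measurableI_less)
  fix c
  let ?V = "\<Union>a\<in>{a. y (lin a) < c}. (\<lambda>x :: 'c poly \<Rightarrow> real. x (lin a)) -` {..<c}"
  have "open ?V"
    by (intro open_UN ballI open_vimage continuous_on_product_coordinates) auto
  moreover have "{x \<in> space (restrict_space borel E). hsia_inf x y < c} = E \<inter> ?V"
  proof -
    have "hsia_inf x y < c \<longleftrightarrow> (\<exists>a. x (lin a) < c \<and> y (lin a) < c)" if "x \<in> E" for x
      unfolding hsia_inf_def using that assms hsia_inf_bdd[of x y]
      by (subst cINF_less_iff) auto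
    then show ?thesis by (auto simp: space_restrict_space)
  qed
  ultimately show "{x \<in> space (restrict_space borel E). hsia_inf x y < c} \<in> sets (restrict_space borel E)"
    by (auto simp: sets_restrict_space)
qed

end

section \<open>The potential of the equilibrium measure\<close>

context marked_tower
begin

lemma disc_dist_col_le:
  assumes "i < d ^ n" and y: "y \<in> limit_set"
  shows "L.disc_dist n i (L.disc_index n y) \<le> R"
proof -
  let ?t = "real i / real d ^ n"
  have "real i < real (d ^ n)" using assms(1) by (simp only: of_nat_less_iff)
  then have t: "?t \<in> {0..<1}" using d by simp
  have "cell_index n ?t = i" using d by (simp add: cell_index_def)
  then show ?thesis using path_dist_le_R[OF t y, of n] by (simp only: path_dist_def)
qed

text \<open>Each cell has mass \<open>1 / real d ^ n\<close>, so the integral is an average over the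
  zeros, and constancy of the potential evaluates it as
  \<open>ln R - ln R / real d ^ n\<close>.\<close>

lemma nn_integral_potential_le:
  assumes y: "y \<in> limit_set"
  shows "(\<integral>\<^sup>+ t. ennreal (ln R - ln (path_dist n t y)) \<partial>unit_measure) \<le> ennreal (ln R)"
proof -
  let ?D = "real d ^ n" and ?j = "L.disc_index n y"
  note j = disc_index_limit_set_less[OF y, of n]
  have D: "?D > 0" using d by simp
  have le: "ln (L.disc_dist n i ?j) \<le> ln R" if "i < d ^ n" for i
    using disc_dist_col_le[OF that y] L.disc_dist_pos[OF that] by (intro ln_mono) auto
  have "(\<integral>\<^sup>+ t. ennreal (ln R - ln (path_dist n t y)) \<partial>unit_measure) =
      (\<Sum>i<d ^ n. ennreal (ln R - ln (L.disc_dist n i ?j)) * ennreal (1 / ?D))"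
    unfolding path_dist_def by (rule nn_integral_cell_index)
  also have "\<dots> = (\<Sum>i<d ^ n. ennreal ((ln R - ln (L.disc_dist n i ?j)) / ?D))"
    using le D by (intro sum.cong refl) (simp add: ennreal_mult[symmetric])
  also have "\<dots> = ennreal (\<Sum>i<d ^ n. (ln R - ln (L.disc_dist n i ?j)) / ?D)"
    using le D by (intro sum_ennreal) simp
  also have "(\<Sum>i<d ^ n. (ln R - ln (L.disc_dist n i ?j)) / ?D) = ln R - ln R / ?D"
  proof -
    have "(\<Sum>i<d ^ n. ln R - ln (L.disc_dist n i ?j)) = ?D * ln R + (\<Sum>i<d ^ n. - ln (L.disc_dist n ?j i))"
      using L.disc_dist_sym[OF _ j] by (simp add: sum_subtractf sum_negf)
    also have "\<dots> = ?D * ln R - ln R" using L.disc_dist_potential[OF j] by simp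
    finally have "(\<Sum>i<d ^ n. ln R - ln (L.disc_dist n i ?j)) / ?D = (?D * ln R - ln R) / ?D" by (simp only:)
    also have "\<dots> = ln R - ln R / ?D" using D by (simp only: diff_divide_distrib) simp
    finally show ?thesis by (simp only: sum_divide_distrib)
  qed
  also have "ennreal (ln R - ln R / ?D) \<le> ennreal (ln R)"
    using D R_ge_1 by (intro ennreal_leI) simp
  finally show ?thesis .
qed

text \<open>If the supremum is finite, the path distances have a positive lower bound, which the
  kernel inherits, so it does not vanish. An infinite supremum leaves nothing to show.\<close>

lemma neg_log_hsia_le_SUP:
  assumes t: "t \<in> {0..<1}" and y: "y \<in> limit_set"
  shows "e2ennreal (neg_log (hsia_inf (end_pt t) y) + ereal C) \<le> (SUP n. ennreal (C - ln (path_dist n t y)))"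
proof (cases "SUP n. ennreal (C - ln (path_dist n t y))")
  case (real s)
  have "exp (C - s) \<le> hsia_inf (end_pt t) y"
  proof (rule hsia_ge_of_path_dist[OF t y])
    fix n
    have "ennreal (C - ln (path_dist n t y)) \<le> ennreal s"
      unfolding real(2)[symmetric] by (rule SUP_upper) simp
    then have "C - s \<le> ln (path_dist n t y)" using real(1) by (simp add: ennreal_le_iff)
    then have "exp (C - s) \<le> exp (ln (path_dist n t y))" by (simp only: exp_le_cancel_iff)
    then show "exp (C - s) \<le> path_dist n t y" by (simp only: exp_ln[OF path_dist_pos[OF t]])
  qed
  moreover from this have pos: "0 < hsia_inf (end_pt t) y" by (rule less_le_trans[OF exp_gt_zero])
  ultimately have "C - s \<le> ln (hsia_inf (end_pt t) y)" by (simp add: ln_ge_iff)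
  then have "neg_log (hsia_inf (end_pt t) y) + ereal C \<le> ereal s" using pos by (simp add: neg_log_def)
  then have "e2ennreal (neg_log (hsia_inf (end_pt t) y) + ereal C) \<le> e2ennreal (ereal s)"
    by (rule e2ennreal_mono)
  then show ?thesis by (simp add: real(2) e2ennreal_ereal)
next
  case top
  then show ?thesis by (simp only: top_greatest)
qed

lemma space_limit_set_measure: "\<nu> \<in> prob_measures_on limit_set \<Longrightarrow> space \<nu> = limit_set"
  using sets_eq_imp_space_eq[of \<nu> "restrict_space borel limit_set"]
  by (simp add: prob_measures_on_def space_restrict_space)

lemma hsia_limit_set_eq: "x \<in> limit_set \<Longrightarrow> y \<in> limit_set \<Longrightarrow> hsia_kernel av x y = hsia_inf x y"
  by (intro hsia_kernel_eq limit_set_berk)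

lemma hsia_le_R:
  assumes x: "x \<in> limit_set" and y: "y \<in> limit_set"
  shows "hsia_inf x y \<le> R"
  using hsia_inf_le[OF limit_set_berk[OF x], of y "\<rho> 0 0"] limit_set_prod[OF x, of 0] limit_set_prod[OF y, of 0] by simp

text \<open>The shift by \<open>ln R\<close> makes the level kernels nonnegative, and they increase
  because path distances decrease, so the bound for each level passes to the limit.\<close>

lemma potential_nonpos:
  assumes y: "y \<in> limit_set"
  shows "ereal_integral equilibrium (\<lambda>x. neg_log (hsia_kernel av x y)) \<le> 0"
proof (rule ereal_integral_nonpos[where C = "ln R"])
  have sp: "space equilibrium = limit_set" by (rule space_limit_set_measure[OF equilibrium_in])
  have sets: "sets equilibrium = sets (restrict_space borel limit_set)" by (simp add: equilibrium_def)
  have meas: "(\<lambda>x. neg_log (hsia_inf x y)) \<in> borel_measurable (restrict_space borel limit_set)"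
    by (rule measurable_compose[OF hsia_inf_measurable measurable_neg_log]) (auto simp: limit_set_def)
  have meas': "(\<lambda>x. e2ennreal (neg_log (hsia_inf x y) + ereal (ln R))) \<in> borel_measurable (restrict_space borel limit_set)"
    using meas by measurable
  show "(\<lambda>x. neg_log (hsia_kernel av x y)) \<in> borel_measurable equilibrium"
    by (subst measurable_cong_sets[OF sets refl], subst measurable_cong[OF _])
       (use meas hsia_limit_set_eq[OF _ y] in \<open>auto simp: space_restrict_space\<close>)
  show "prob_space equilibrium" using equilibrium_in by (simp add: prob_measures_on_def)
  show "ln R \<ge> 0" using R_ge_1 by simp
  show "- ereal (ln R) \<le> neg_log (hsia_kernel av x y)" if "x \<in> space equilibrium" for x
    using neg_log_antimono[OF hsia_inf_nonneg hsia_le_R, of x y] that y R_ge_1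
    by (simp add: sp hsia_limit_set_eq limit_set_berk)
  have "(\<integral>\<^sup>+ x. e2ennreal (neg_log (hsia_kernel av x y) + ereal (ln R)) \<partial>equilibrium) =
      (\<integral>\<^sup>+ x. e2ennreal (neg_log (hsia_inf x y) + ereal (ln R)) \<partial>equilibrium)"
    by (intro nn_integral_cong) (simp add: sp hsia_limit_set_eq[OF _ y])
  also have "\<dots> = (\<integral>\<^sup>+ t. e2ennreal (neg_log (hsia_inf (end_pt t) y) + ereal (ln R)) \<partial>unit_measure)"
    unfolding equilibrium_def using meas' by (intro nn_integral_distr end_pt_measurable) simp
  also have "\<dots> \<le> (\<integral>\<^sup>+ t. (SUP n. ennreal (ln R - ln (path_dist n t y))) \<partial>unit_measure)"
    by (intro nn_integral_mono neg_log_hsia_le_SUP y) simp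
  also have "\<dots> = (SUP n. \<integral>\<^sup>+ t. ennreal (ln R - ln (path_dist n t y)) \<partial>unit_measure)"
  proof (rule nn_integral_monotone_convergence_SUP_AE)
    fix n
    show "AE t in unit_measure. ennreal (ln R - ln (path_dist n t y)) \<le> ennreal (ln R - ln (path_dist (Suc n) t y))"
    proof (rule AE_I2)
      fix t assume "t \<in> space unit_measure"
      then have t: "t \<in> {0..<1}" by simp
      have "ln (path_dist (Suc n) t y) \<le> ln (path_dist n t y)"
        using path_dist_Suc_le[OF t y] path_dist_pos[OF t] by (intro ln_mono) auto
      then show "ennreal (ln R - ln (path_dist n t y)) \<le> ennreal (ln R - ln (path_dist (Suc n) t y))"
        by (intro ennreal_leI) simp
    qed
    show "(\<lambda>t. ennreal (ln R - ln (path_dist n t y))) \<in> borel_measurable unit_measure"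
      unfolding path_dist_def
      by (rule measurable_compose[OF cell_index_measurable, of "\<lambda>i. ennreal (ln R - ln (L.disc_dist n i (L.disc_index n y)))"]) simp
  qed
  also have "\<dots> \<le> ennreal (ln R)" by (intro SUP_least nn_integral_potential_le y)
  finally show "(\<integral>\<^sup>+ x. e2ennreal (neg_log (hsia_kernel av x y) + ereal (ln R)) \<partial>equilibrium) \<le> ennreal (ln R)" .
qed

lemma energy_equilibrium: "energy av equilibrium \<le> 0"
proof -
  have "energy av equilibrium \<le> ereal_integral equilibrium (\<lambda>_. 0)"
    unfolding energy_def
    by (intro ereal_integral_mono potential_nonpos) (simp add: space_limit_set_measure[OF equilibrium_in])
  also have "\<dots> = 0"
    using ereal_integral_ereal[of equilibrium "\<lambda>_. 0"] by (simp add: zero_ereal_def)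
  finally show ?thesis .
qed

section \<open>The lower bound for the energy, and the capacity\<close>

lemma coordinate_measurable: "(\<lambda>x. x f) \<in> borel_measurable (restrict_space borel limit_set)"
  by (intro measurable_restrict_space1 borel_measurable_continuous_onI continuous_on_product_coordinates)

lemma disc_index_measurable: "L.disc_index n \<in> measurable (restrict_space borel limit_set) (count_space UNIV)"
proof -
  note coordinate_measurable[measurable]
  show ?thesis unfolding L.disc_index_def[abs_def] by measurable
qed

text \<open>Replacing the Hsia kernel by the larger level-n disc distance does not raise the energy
  and leaves a step function, whose energy is a finite quadratic form in the masses of the
  discs.\<close>

lemma energy_ge:
  assumes \<nu>: "\<nu> \<in> prob_measures_on limit_set"
  shows "ereal (- ln R / real d ^ n) \<le> energy av \<nu>"
proof -
  interpret \<nu>: prob_space \<nu> using \<nu> by (simp add: prob_measures_on_def)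
  have sp: "space \<nu> = limit_set" by (rule space_limit_set_measure[OF \<nu>])
  have sets: "sets \<nu> = sets (restrict_space borel limit_set)" using \<nu> by (simp add: prob_measures_on_def)
  define A where "A i = L.disc_index n -` {i} \<inter> space \<nu>" for i
  have disc_index_meas: "L.disc_index n \<in> measurable \<nu> (count_space UNIV)"
    using disc_index_measurable by (simp add: measurable_cong_sets[OF sets refl])
  have A: "A i \<in> sets \<nu>" for i
    unfolding A_def by (rule measurable_sets[OF disc_index_meas]) simp
  define m where "m i = measure \<nu> (A i)" for i
  have ind: "g (L.disc_index n x) = (\<Sum>i<d ^ n. g i * indicator (A i) x)" if "x \<in> space \<nu>" for g :: "nat \<Rightarrow> real" and x
  proof -
    have "(\<Sum>i<d ^ n. g i * indicator (A i) x) = (\<Sum>i\<in>{L.disc_index n x}. g i * indicator (A i) x)"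
      using that disc_index_limit_set_less[of x n] sp by (intro sum.mono_neutral_right) (auto simp: A_def indicator_def)
    then show ?thesis using that by (simp add: A_def indicator_def)
  qed
  have int: "integrable \<nu> (\<lambda>x. g i * indicator (A i) x)" for g :: "nat \<Rightarrow> real" and i
    using A by (intro integrable_mult_right integrable_real_indicator) (auto simp: \<nu>.emeasure_eq_measure)
  have integrable: "integrable \<nu> (\<lambda>x. g (L.disc_index n x))" for g :: "nat \<Rightarrow> real"
  proof -
    have "integrable \<nu> (\<lambda>x. \<Sum>i<d ^ n. g i * indicator (A i) x)"
      by (intro Bochner_Integration.integrable_sum int)
    moreover have "integrable \<nu> (\<lambda>x. g (L.disc_index n x)) \<longleftrightarrow>
        integrable \<nu> (\<lambda>x. \<Sum>i<d ^ n. g i * indicator (A i) x)"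
      by (rule Bochner_Integration.integrable_cong) (simp_all only: ind)
    ultimately show ?thesis by (simp only:)
  qed
  have integral: "(\<integral>x. g (L.disc_index n x) \<partial>\<nu>) = (\<Sum>i<d ^ n. m i * g i)" for g :: "nat \<Rightarrow> real"
  proof -
    have "(\<integral>x. g (L.disc_index n x) \<partial>\<nu>) = (\<integral>x. (\<Sum>i<d ^ n. g i * indicator (A i) x) \<partial>\<nu>)"
      by (rule Bochner_Integration.integral_cong[OF refl ind])
    also have "\<dots> = (\<Sum>i<d ^ n. \<integral>x. g i * indicator (A i) x \<partial>\<nu>)"
      by (intro Bochner_Integration.integral_sum int)
    also have "\<dots> = (\<Sum>i<d ^ n. m i * g i)"
      using A sets.sets_into_space[OF A] by (intro sum.cong refl) (simp add: m_def Int_absorb2 mult.commute)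
    finally show ?thesis .
  qed
  let ?k = "\<lambda>i j. - ln (L.disc_dist n i j)"
  define u where "u j = (\<Sum>i<d ^ n. m i * ?k i j)" for j
  have inner: "ereal (u (L.disc_index n y)) \<le> ereal_integral \<nu> (\<lambda>x. neg_log (hsia_kernel av x y))"
    if y: "y \<in> space \<nu>" for y
  proof -
    have "ereal (u (L.disc_index n y)) = ereal_integral \<nu> (\<lambda>x. ereal (?k (L.disc_index n x) (L.disc_index n y)))"
      unfolding u_def integral[symmetric] by (rule ereal_integral_ereal[OF integrable, symmetric])
    also have "\<dots> \<le> ereal_integral \<nu> (\<lambda>x. neg_log (hsia_kernel av x y))"
    proof (rule ereal_integral_mono)
      fix x assume x: "x \<in> space \<nu>"
      have xM: "x \<in> limit_set" and yM: "y \<in> limit_set" using x y by (simp_all add: sp)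
      have "hsia_inf x y \<le> L.disc_dist n (L.disc_index n x) (L.disc_index n y)"
        by (rule order.trans[OF hsia_inf_le[OF limit_set_berk[OF xM], of y "\<rho> n (L.disc_index n x)"]
              L.max_le_disc_dist[OF limit_set_berk[OF xM] limit_set_berk[OF yM] disc_index_limit_set_less[OF xM] disc_index_limit_set_less[OF yM]
                disc_index_limit_set_disc[OF xM] disc_index_limit_set_disc[OF yM]]])
      then show "ereal (?k (L.disc_index n x) (L.disc_index n y)) \<le> neg_log (hsia_kernel av x y)"
        unfolding hsia_limit_set_eq[OF xM yM]
        by (intro neg_log_antimono hsia_inf_nonneg limit_set_berk xM L.disc_dist_pos disc_index_limit_set_less)
    qed
    finally show ?thesis .
  qed
  have "(\<Sum>i<d ^ n. m i) = 1"
    using integral[of "\<lambda>_. 1"] \<nu>.prob_space by simp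
  then have "- ln R / real (d ^ n) \<le> (\<Sum>i<d ^ n. \<Sum>j<d ^ n. m i * m j * ?k i j)"
    by (rule L.energy_lower_bound)
  also have "\<dots> = (\<Sum>j<d ^ n. m j * u j)"
    unfolding u_def sum_distrib_left by (subst sum.swap) (simp add: mult_ac)
  finally have "- ln R / real d ^ n \<le> (\<Sum>j<d ^ n. m j * u j)" by simp
  then have "ereal (- ln R / real d ^ n) \<le> ereal (\<integral>y. u (L.disc_index n y) \<partial>\<nu>)" by (simp only: integral ereal_less_eq)
  also have "\<dots> = ereal_integral \<nu> (\<lambda>y. ereal (u (L.disc_index n y)))"
    by (rule ereal_integral_ereal[OF integrable, symmetric])
  also have "\<dots> \<le> energy av \<nu>"
    unfolding energy_def by (rule ereal_integral_mono[OF inner])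
  finally show ?thesis .
qed

lemma log_capacity_limit_set: "log_capacity av limit_set = 1"
proof -
  have lower: "0 \<le> energy av \<nu>" if "\<nu> \<in> prob_measures_on limit_set" for \<nu>
  proof (rule LIMSEQ_le_const2)
    have "(\<lambda>n. (1 / real d) ^ n) \<longlonglongrightarrow> 0" using d by (intro LIMSEQ_power_zero) simp
    then have "(\<lambda>n. - ln R * (1 / real d) ^ n) \<longlonglongrightarrow> 0" by (rule tendsto_mult_right_zero)
    then have "(\<lambda>n. ereal (- ln R * (1 / real d) ^ n)) \<longlonglongrightarrow> ereal 0" by (rule tendsto_ereal)
    then show "(\<lambda>n. ereal (- ln R / real d ^ n)) \<longlonglongrightarrow> 0" by (simp add: power_divide zero_ereal_def)
    show "\<exists>N. \<forall>n\<ge>N. ereal (- ln R / real d ^ n) \<le> energy av \<nu>" using energy_ge[OF that] by blast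
  qed
  have "robin_constant av limit_set = 0"
    unfolding robin_constant_def
    by (intro antisym INF_greatest lower) (rule INF_lower2[OF equilibrium_in], rule energy_equilibrium)
  then show ?thesis by (simp add: log_capacity_def zero_ereal_def one_ereal_def)
qed

end

lemma (in escape_tower) log_capacity_eq_1:
  "log_capacity av {x \<in> berk_line av. \<forall>n. x (P n) \<le> R} = 1"
proof -
  obtain \<rho> where \<rho>: "\<And>n. is_enum n (\<rho> n)"
    "\<And>n k. k < d ^ Suc n \<Longrightarrow> av (\<rho> (Suc n) k - \<rho> n (k div d)) \<le> lemniscate.rad av (\<rho> n) (d ^ n) R (k div d)"
    using nested_enum_exists by blast
  interpret marked_tower av P d R \<rho> by unfold_locales (use \<rho> in auto)
  show ?thesis using log_capacity_limit_set by (simp only: limit_set_def)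
qed

lemma (in nonarch_field) log_capacity_mandelbrot:
  assumes "d \<ge> 2"
  shows "log_capacity av (mandelbrot av d g) = 1"
proof -
  interpret escape_tower av "\<lambda>n. orbit_poly d g (Suc n)" d "max 1 (av g)"
  proof unfold_locales
    fix n
    show "Polynomial.lead_coeff (orbit_poly d g (Suc n)) = 1"
      "Polynomial.degree (orbit_poly d g (Suc n)) = d ^ n"
      using orbit_poly_monic[OF assms] by blast+
  qed (use assms orbit_poly_escape[OF _ assms] in \<open>auto simp del: orbit_poly.simps\<close>)
  show ?thesis using log_capacity_eq_1 by (simp only: mandelbrot_eq[OF assms])
qed

theorem theorem3p5:
  fixes p d :: nat
    and \<iota> :: "'p::prime_card Fp_bar_t \<Rightarrow> 'l::field"
    and \<gamma> :: 'l
    and v :: "'l \<Rightarrow> real"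
    and \<sigma> :: "'l \<Rightarrow> 'c::alg_closed_field"
    and av :: "'c \<Rightarrow> real"
  assumes "prime p" and "CARD('p) = p"
    and "field_hom \<iota>"
    and "\<forall>n. \<exists>x. x ^ (p ^ n) = \<iota> ratfun_var"
    and "is_finite_extension_of (perfect_ratfun_field \<iota>)"
    and "d \<ge> 2"
    and "v \<in> places_above \<iota>"
    and "is_complete_extension v \<sigma> av"
  shows "log_capacity av (mandelbrot av d (\<sigma> \<gamma>)) = 1"
proof -
  interpret \<iota>: field_hom \<iota> by fact
  interpret \<sigma>: field_hom \<sigma> using assms(8) by (simp add: is_complete_extension_def)
  \<comment> \<open>The characteristic is carried to \<open>'c\<close> through both homomorphisms,
    which makes Frobenius available there.\<close>
  have "(of_nat p :: 'p Fp_bar) = 0"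
    by (simp add: of_nat_eq_0_iff_char_dvd CHAR_alg_closure assms(2))
  then have "(of_nat p :: 'p Fp_bar_t) = 0"
    by (simp add: of_nat_fract of_nat_poly Zero_fract_def)
  then have "of_nat p = (0 :: 'c)"
    by (metis \<iota>.hom_of_nat \<iota>.hom_zero \<sigma>.hom_of_nat \<sigma>.hom_zero)
  then have "CHAR('c) dvd p" by (simp add: of_nat_eq_0_iff_char_dvd)
  then have "CHAR('c) = p" using assms(1) by (auto simp: prime_nat_iff)
  have "nonarch_field av"
  proof
    show "absolute_value av" using assms(8) by (simp add: is_complete_extension_def)
    show "prime CHAR('c)" using assms(1) \<open>CHAR('c) = p\<close> by simp
    obtain x where x: "x \<noteq> 0" "v (\<iota> x) \<noteq> 1" using assms(7) by (auto simp: places_above_def)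
    then have "\<sigma> (\<iota> x) \<noteq> 0 \<and> av (\<sigma> (\<iota> x)) \<noteq> 1"
      using assms(8) by (simp add: is_complete_extension_def)
    then show "\<exists>c. c \<noteq> 0 \<and> av c \<noteq> 1" by blast
  qed
  then show ?thesis using assms(6) by (rule nonarch_field.log_capacity_mandelbrot)
qed

end
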